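(* Let $u=2(u_1,u_2,u_3)\in D_3$ with $u_1,u_2,u_3\in\mathbb Z$ such that $u_i\ne u_j$ for $i\neq j$ and $u_1+u_2+u_3\not\equiv0\bmod3$. Then $\sigma_{A_2}|_u$ is a Jacobi cusp form of critical weight $1$ (and index one) with character $v_\eta^8$.
   Context: **Jacobi forms of index one.** Let $L$ be a positive definite even lattice with form $(\cdot,\cdot)$ (extended bilinearly to $L\otimes\mathbb C$) and dual $L^\vee$. $v_\eta$ is the multiplier system of the Dedekind eta function: $\eta(\frac{a\tau+b}{c\tau+d})=v_\eta(A)(c\tau+d)^{1/2}\eta(\tau)$. For $k\in\frac12\mathbb Z$, $D\in\mathbb Z$, $J_{k,L}(v_\eta^D)$ is the space of holomorphic $\varphi:\mathbb H\times(L\otimes\mathbb C)\to\mathbb C$ such that $\varphi(\frac{a\tau+b}{c\tau+d},\frac{\mathfrak Z}{c\tau+d})=v_\eta^D(A)(c\tau+d)^ke^{\pi i\frac{c(\mathfrak Z,\mathfrak Z)}{c\tau+d}}\varphi(\tau,\mathfrak Z)$ for all $A=\begin{pmatrix}a&b\\c&d\end{pmatrix}\in\mathrm{SL}_2(\mathbb Z)$, $\varphi(\tau,\mathfrak Z+x\tau+y)=e^{-\pi i((x,x)\tau+2(x,\mathfrak Z))}\varphi(\tau,\mathfrak Z)$ for $x,y\in L$, and $\varphi=\sum f(n,l)e^{2\pi i(n\tau+(l,\mathfrak Z))}$ with the sum over rational $n\ge0$, $n\equiv\frac D{24}\bmod\mathbb Z$, $l\in L^\vee$, $2n-(l,l)\ge0$.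 It is a cusp form if $f(n,l)\ne0$ only for $2n-(l,l)>0$. The critical weight for $L$ is $\frac{\mathrm{rank}L+1}2$. **Objects.** $\vartheta(\tau,z)=\sum_{n\in\mathbb Z}\left(\frac{-4}n\right)e^{2\pi i(\frac{n^2}8\tau+\frac n2z)}$, where $\left(\frac{-4}n\right)$ is $1,-1,0$ for $n\equiv1\bmod4$, $n\equiv3\bmod4$, $n$ even. $D_3=\{x\in\mathbb Z^3:x_1+x_2+x_3\in2\mathbb Z\}$ and $A_2=\{x\in\mathbb Z^3:x_1+x_2+x_3=0\}=v^\perp_{D_3}$ for $v=2(1,1,1)$, with the Euclidean form; points of $A_2\otimes\mathbb C$ are $(z_1,z_2,-z_1-z_2)$. The function $\sigma_{A_2}(\tau,z_1,z_2)=\vartheta(\tau,z_1)\vartheta(\tau,z_2)\vartheta(\tau,z_1+z_2)/\eta(\tau)$ belongs to $J_{1,A_2}(v_\eta^8)$. For $u\in D_3$ let $u_a\in A_2^\vee$ be the orthogonal projection of $u$ to $A_2\otimes\mathbb Q$, let $(u_a)^\perp_{A_2}$ be the sublattice of $A_2$ orthogonal to $u_a$, and let $\sigma_{A_2}|_u$ be the restriction of $\sigma_{A_2}(\tau,\mathfrak Z)$ to $\mathfrak Z\in(u_a)^\perp_{A_2}\otimes\mathbb C$, a function on $\mathbb H\times((u_a)^\perp_{A_2}\otimes\mathbb C)$, viewed as a Jacobi form for the rank-one lattice $(u_a)^\perp_{A_2}$. *)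

theory Defs
  imports "HOL-Analysis.Analysis"
begin

section \<open>Lattices in Euclidean space\<close>

text \<open>A positive definite lattice is given by an embedding into some \<open>real ^ 'n\<close> with the standard
  inner product; it need not have full rank.\<close>

definition int_lattice :: "(real ^ 'n) set \<Rightarrow> bool" where
  "int_lattice L \<longleftrightarrow>
     (\<exists>B. independent B \<and> L = {\<Sum>b\<in>B. of_int (c b) *\<^sub>R b | c :: real ^ 'n \<Rightarrow> int. True})"

definition even_lattice :: "(real ^ 'n) set \<Rightarrow> bool" where
  "even_lattice L \<longleftrightarrow> int_lattice L \<and> (\<forall>x\<in>L. \<exists>m::int. x \<bullet> x = 2 * of_int m)"

text \<open>\<open>L \<otimes> \<rat>\<close>: every element of the rational span of a lattice is a rational multiple of a
  single lattice vector.\<close>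

definition tensor_rat :: "(real ^ 'n) set \<Rightarrow> (real ^ 'n) set" where
  "tensor_rat L = {q *\<^sub>R x | q x. q \<in> \<rat> \<and> x \<in> L}"

definition cvec :: "real ^ 'n \<Rightarrow> complex ^ 'n" where
  "cvec x = (\<chi> i. complex_of_real (x $ i))"

text \<open>\<open>L \<otimes> \<complex>\<close>, as a complex subspace of \<open>complex ^ 'n\<close>.\<close>

definition tensor_complex :: "(real ^ 'n) set \<Rightarrow> (complex ^ 'n) set" where
  "tensor_complex L = vec.span (cvec ` L)"

definition dual_lattice :: "(real ^ 'n) set \<Rightarrow> (real ^ 'n) set" where
  "dual_lattice L = {l \<in> tensor_rat L. \<forall>x\<in>L. l \<bullet> x \<in> \<int>}"

text \<open>The complex bilinear (not Hermitian) extension of the inner product.\<close>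

definition cform :: "complex ^ 'n \<Rightarrow> complex ^ 'n \<Rightarrow> complex" where
  "cform z w = (\<Sum>i\<in>UNIV. z $ i * w $ i)"

definition orth_projection :: "(real ^ 'n) set \<Rightarrow> real ^ 'n \<Rightarrow> real ^ 'n" where
  "orth_projection V x = (THE y. y \<in> V \<and> (\<forall>w\<in>V. (x - y) \<bullet> w = 0))"

definition orth_sublattice :: "(real ^ 'n) set \<Rightarrow> real ^ 'n \<Rightarrow> (real ^ 'n) set" where
  "orth_sublattice L w = {x \<in> L. x \<bullet> w = 0}"

definition critical_weight :: "(real ^ 'n) set \<Rightarrow> real" where
  "critical_weight L = (real (dim L) + 1) / 2"


section \<open>Eta function, its multiplier system, and theta function\<close>

definition upper_half :: "complex set" where
  "upper_half = {\<tau>. Im \<tau> > 0}"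

definition dedekind_eta :: "complex \<Rightarrow> complex" where
  "dedekind_eta \<tau> = exp (pi * \<i> * \<tau> / 12) * (\<Prod>n. 1 - exp (2 * pi * \<i> * of_nat (Suc n) * \<tau>))"

text \<open>The matrix with rows \<open>(a, b)\<close> and \<open>(c, d)\<close> is passed as four integers. The half-integral
  power uses \<open>powr\<close>, i.e. the principal branch, here and in \<open>jacobi_form\<close>.\<close>

definition v_eta :: "int \<Rightarrow> int \<Rightarrow> int \<Rightarrow> int \<Rightarrow> complex" where
  "v_eta a b c d = (THE v. \<forall>\<tau>\<in>upper_half.
     dedekind_eta ((of_int a * \<tau> + of_int b) / (of_int c * \<tau> + of_int d)) =
       v * (of_int c * \<tau> + of_int d) powr (1 / 2) * dedekind_eta \<tau>)"

text \<open>The Kronecker symbol \<open>(-4 / n)\<close>.\<close>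

definition chi4 :: "int \<Rightarrow> int" where
  "chi4 n = (if n mod 4 = 1 then 1 else if n mod 4 = 3 then -1 else 0)"

definition theta :: "complex \<Rightarrow> complex \<Rightarrow> complex" where
  "theta \<tau> z = (\<Sum>\<^sub>\<infinity>n\<in>(UNIV::int set).
     of_int (chi4 n) * exp (2 * pi * \<i> * (of_int n ^ 2 / 8 * \<tau> + of_int n / 2 * z)))"


section \<open>Jacobi forms of index one\<close>

text \<open>Holomorphy on a relatively open subset of a complex subspace of \<open>\<complex> \<times> \<complex>\<^sup>n\<close>: the
  Frechet derivative within the set exists and can be chosen complex linear (it is
  unique only along the subspace).\<close>

definition holomorphic_within :: "(complex \<times> (complex ^ 'n) \<Rightarrow> complex) \<Rightarrow> (complex \<times> (complex ^ 'n)) set \<Rightarrow> bool"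
  where
  "holomorphic_within f S \<longleftrightarrow> (\<forall>p\<in>S. \<exists>D. (f has_derivative D) (at p within S) \<and>
     (\<forall>c v w. D (c * v, c *s w) = c * D (v, w)))"

definition jacobi_index_set :: "(real ^ 'n) set \<Rightarrow> int \<Rightarrow> (real \<times> (real ^ 'n)) set" where
  "jacobi_index_set L D = {(n, l). n \<in> \<rat> \<and> n \<ge> 0 \<and> n - of_int D / 24 \<in> \<int> \<and>
     l \<in> dual_lattice L \<and> 2 * n - l \<bullet> l \<ge> 0}"

definition jacobi_fourier_expansion ::
    "(real ^ 'n) set \<Rightarrow> int \<Rightarrow> (complex \<times> (complex ^ 'n) \<Rightarrow> complex) \<Rightarrow> (real \<Rightarrow> real ^ 'n \<Rightarrow> complex) \<Rightarrow> bool"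
  where
  "jacobi_fourier_expansion L D \<phi> f \<longleftrightarrow> (\<forall>\<tau>\<in>upper_half. \<forall>Z\<in>tensor_complex L.
     ((\<lambda>(n, l). f n l * exp (2 * pi * \<i> * (of_real n * \<tau> + cform (cvec l) Z))) has_sum \<phi> (\<tau>, Z))
       (jacobi_index_set L D))"

text \<open>\<open>jacobi_form L k D \<phi>\<close> means that \<open>L\<close> is a positive definite even lattice and that \<open>\<phi>\<close>
  belongs to \<open>J_{k,L}(v_\<eta>^D)\<close>. Only the values of \<open>\<phi>\<close> on
  \<open>upper_half \<times> tensor_complex L\<close> matter.\<close>

definition jacobi_form :: "(real ^ 'n) set \<Rightarrow> real \<Rightarrow> int \<Rightarrow> (complex \<times> (complex ^ 'n) \<Rightarrow> complex) \<Rightarrow> bool"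
  where
  "jacobi_form L k D \<phi> \<longleftrightarrow>
     even_lattice L \<and> 2 * k \<in> \<int> \<and>
     holomorphic_within \<phi> (upper_half \<times> tensor_complex L) \<and>
     (\<forall>a b c d :: int. a * d - b * c = 1 \<longrightarrow> (\<forall>\<tau>\<in>upper_half. \<forall>Z\<in>tensor_complex L.
        \<phi> ((of_int a * \<tau> + of_int b) / (of_int c * \<tau> + of_int d),
           (1 / (of_int c * \<tau> + of_int d)) *s Z) =
          v_eta a b c d powi D * (of_int c * \<tau> + of_int d) powr (of_real k) *
          exp (pi * \<i> * (of_int c * cform Z Z / (of_int c * \<tau> + of_int d))) * \<phi> (\<tau>, Z))) \<and>
     (\<forall>x\<in>L. \<forall>y\<in>L. \<forall>\<tau>\<in>upper_half. \<forall>Z\<in>tensor_complex L.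
        \<phi> (\<tau>, Z + \<tau> *s cvec x + cvec y) =
          exp (- pi * \<i> * (of_real (x \<bullet> x) * \<tau> + 2 * cform (cvec x) Z)) * \<phi> (\<tau>, Z)) \<and>
     (\<exists>f. jacobi_fourier_expansion L D \<phi> f)"

text \<open>The Fourier coefficients of a Jacobi form are unique on the index set, so it does not
  matter that the expansion is quantified existentially.\<close>

definition jacobi_cusp_form :: "(real ^ 'n) set \<Rightarrow> real \<Rightarrow> int \<Rightarrow> (complex \<times> (complex ^ 'n) \<Rightarrow> complex) \<Rightarrow> bool"
  where
  "jacobi_cusp_form L k D \<phi> \<longleftrightarrow> jacobi_form L k D \<phi> \<and>
     (\<exists>f. jacobi_fourier_expansion L D \<phi> f \<and>
        (\<forall>(n, l)\<in>jacobi_index_set L D. f n l \<noteq> 0 \<longrightarrow> 2 * n - l \<bullet> l > 0))"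


section \<open>The lattices and the function for $A_2$\<close>

definition D3_lattice :: "(real ^ 3) set" where
  "D3_lattice = {x. (\<forall>i. x $ i \<in> \<int>) \<and> (\<exists>m::int. x $ 1 + x $ 2 + x $ 3 = 2 * of_int m)}"

definition A2_lattice :: "(real ^ 3) set" where
  "A2_lattice = {x. (\<forall>i. x $ i \<in> \<int>) \<and> x $ 1 + x $ 2 + x $ 3 = 0}"

text \<open>Points of \<open>A\<^sub>2 \<otimes> \<complex>\<close> are \<open>(z\<^sub>1, z\<^sub>2, - z\<^sub>1 - z\<^sub>2)\<close>, so the first two components
  are the coordinates.\<close>

definition sigma_A2 :: "complex \<times> (complex ^ 3) \<Rightarrow> complex" where
  "sigma_A2 = (\<lambda>(\<tau>, Z).
     theta \<tau> (Z $ 1) * theta \<tau> (Z $ 2) * theta \<tau> (Z $ 1 + Z $ 2) / dedekind_eta \<tau>)"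

text \<open>The sublattice of \<open>A\<^sub>2\<close> orthogonal to the projection \<open>u_a\<close> of \<open>u\<close>.\<close>

definition A2_perp :: "real ^ 3 \<Rightarrow> (real ^ 3) set" where
  "A2_perp u = orth_sublattice A2_lattice (orth_projection (tensor_rat A2_lattice) u)"

definition sigma_A2_restr :: "real ^ 3 \<Rightarrow> complex \<times> (complex ^ 3) \<Rightarrow> complex" where
  "sigma_A2_restr u = restrict sigma_A2 (upper_half \<times> tensor_complex (A2_perp u))"

end

theory Submission
  imports Defs "HOL-Complex_Analysis.Complex_Analysis"
begin

text \<open>The sublattice of \<open>A\<^sub>2\<close> orthogonal to \<open>u\<^sub>a\<close> is generated by a primitive vector
  \<open>w = (p, q, - p - q)\<close> proportional to \<open>(u\<^sub>2 - u\<^sub>3, u\<^sub>3 - u\<^sub>1, u\<^sub>1 - u\<^sub>2)\<close>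
  (\<open>A2_perp_eq_line\<close>). Its norm is \<open>2N\<close> with \<open>N = p\<^sup>2 + pq + q\<^sup>2\<close>, and \<open>N\<close> is congruent to
  \<open>(p - q)\<^sup>2\<close> modulo 3, which is nonzero because \<open>u\<^sub>1 + u\<^sub>2 + u\<^sub>3\<close> is not divisible by 3.

  The cusp condition is then pure arithmetic (\<open>jacobi_index_set_positive\<close>): the character
  \<open>v\<^sub>\<eta>\<^sup>8\<close> forces \<open>n \<equiv> 1/3\<close> modulo 1, and \<open>2n = (l, l)\<close> would make \<open>3\<close> divide \<open>N\<close>.
  It remains to see that \<open>\<vartheta>(z\<^sub>1) \<vartheta>(z\<^sub>2) \<vartheta>(z\<^sub>1 + z\<^sub>2) / \<eta>\<close> restricts to a Jacobi form.

  The Fourier expansion is the product of the three theta series and the \<open>q\<close>-series of \<open>1/\<eta>\<close>;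
  the inequality \<open>2n \<ge> (l, l)\<close> for its exponents is a Gram determinant estimate
  (\<open>gram_bound\<close>). The elliptic transformation law is immediate from the theta series
  (\<open>theta_add_lattice\<close>).

  The modular transformation law needs that \<open>\<eta>\<close> and \<open>\<vartheta>\<close> transform with multipliers \<open>v\<^sub>\<eta>\<close> and
  \<open>v\<^sub>\<eta>\<^sup>3\<close>, which is proved for all of \<open>SL\<^sub>2(\<int>)\<close> at once, without generators. Jacobi's triple
  product (\<open>triple_product\<close>, as a limit of the \<open>q\<close>-binomial theorem) shows that
  \<open>\<vartheta>(\<tau>, \<cdot>)\<close> vanishes only on \<open>\<int>\<tau> + \<int>\<close> and that \<open>\<vartheta>'(0) = 2\<pi>i \<eta>\<^sup>3\<close>
  (\<open>theta_moment_1_eq_eta_cubed\<close>). For \<open>A\<close> with lower row \<open>(c, d)\<close> the function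
  \<open>exp(- \<pi>i c z\<^sup>2 / (c\<tau> + d)) \<vartheta>(A\<tau>, z / (c\<tau> + d))\<close> has the quasi-periods of \<open>\<vartheta>(\<tau>, z)\<close> up to
  factors of absolute value one, so by Liouville's theorem it is a constant multiple
  \<open>C \<vartheta>(\<tau>, z)\<close> (\<open>theta_transform_const\<close>). Comparing the Taylor coefficients of \<open>z\<close> and \<open>z\<^sup>3\<close>
  and using the heat equation gives the transformation of \<open>\<eta>'/\<eta>\<close>
  (\<open>eta_deriv_transform\<close>), hence of \<open>\<eta>\<close>; the coefficient of \<open>z\<close> then gives
  \<open>C = v\<^sub>\<eta>\<^sup>3 (c\<tau> + d)\<^bsup>1/2\<^esup>\<close>.\<close>

section \<open>The theta series and its derivatives\<close>

text \<open>The summands of \<open>\<vartheta>\<close>, weighted by \<open>n\<^sup>k\<close>. Up to powers of \<open>\<pi>i\<close> the weighted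
  sums are the derivatives of \<open>\<vartheta>\<close>: each power of \<open>n\<close> is one derivative in \<open>z\<close>, and two
  powers are one derivative in \<open>\<tau>\<close>.\<close>

definition theta_term :: "nat \<Rightarrow> complex \<Rightarrow> complex \<Rightarrow> int \<Rightarrow> complex" where
  "theta_term k \<tau> z n = of_int (chi4 n) * of_int n ^ k *
     exp (2 * pi * \<i> * (of_int n ^ 2 / 8 * \<tau> + of_int n / 2 * z))"

definition theta_moment :: "nat \<Rightarrow> complex \<Rightarrow> complex \<Rightarrow> complex" where
  "theta_moment k \<tau> z = (\<Sum>\<^sub>\<infinity>n. theta_term k \<tau> z n)"

lemma theta_eq_moment: "theta = theta_moment 0"
  by (simp add: fun_eq_iff theta_def theta_moment_def theta_term_def)

lemma summable_exp_minus_abs_int: "(\<lambda>n::int. exp (- \<bar>real_of_int n\<bar>)) summable_on UNIV"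
proof -
  have s: "summable (\<lambda>n::nat. norm (exp (- real n)))"
  proof -
    have "(\<lambda>n::nat. norm (exp (- real n))) = (\<lambda>n. exp (-1) ^ n)"
      by (simp add: fun_eq_iff flip: exp_of_nat_mult)
    then show ?thesis by (simp add: summable_geometric)
  qed
  have s1: "(\<lambda>n::nat. exp (- real n)) summable_on UNIV"
    using s by (rule norm_summable_imp_summable_on)
  have "(\<lambda>n::int. exp (- \<bar>real_of_int n\<bar>)) summable_on range int"
    by (subst summable_on_reindex) (use s1 in \<open>auto simp: o_def\<close>)
  moreover have "(\<lambda>n::int. exp (- \<bar>real_of_int n\<bar>)) summable_on range (\<lambda>n. - int n)"
    by (subst summable_on_reindex) (use s1 in \<open>auto simp: o_def inj_on_def\<close>)
  ultimately have "(\<lambda>n::int. exp (- \<bar>real_of_int n\<bar>)) summable_on (range int \<union> range (\<lambda>n. - int n))"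
    by (rule summable_on_union)
  moreover have "range int \<union> range (\<lambda>n. - int n) = UNIV"
  proof -
    have "n \<in> range int \<union> range (\<lambda>n. - int n)" for n
      by (cases n rule: int_cases2) auto
    then show ?thesis by blast
  qed
  ultimately show ?thesis by simp
qed

lemma abs_chi4_le: "\<bar>chi4 n\<bar> \<le> 1"
  by (simp add: chi4_def)

lemma power_le_fact_exp: "x \<ge> 0 \<Longrightarrow> x ^ k \<le> fact k * exp (x::real)"
proof -
  assume x: "x \<ge> 0"
  have "x ^ k / fact k = (\<Sum>n\<in>{k}. x ^ n / fact n)" by simp
  also have "\<dots> \<le> (\<Sum>n. x ^ n / fact n)"
    using x summable_exp[of x] by (intro sum_le_suminf) (auto simp: field_simps)
  also have "\<dots> = exp x"
    by (simp add: exp_def field_simps)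
  finally show ?thesis by (simp add: field_simps)
qed

text \<open>A constant for which the summands are at most \<open>theta_bound k \<delta> R * exp (- \<bar>n\<bar>)\<close> on
  \<open>Im \<tau> \<ge> \<delta>\<close>, \<open>\<bar>z\<bar> \<le> R\<close>. It comes from \<open>t\<^sup>k \<le> k! e\<^sup>t\<close> and from completing the square in
  \<open>- \<pi>\<delta>t\<^sup>2/4 + (\<pi>R + 2) t\<close>, where \<open>t = \<bar>n\<bar>\<close>.\<close>

definition theta_bound :: "nat \<Rightarrow> real \<Rightarrow> real \<Rightarrow> real" where
  "theta_bound k \<delta> R = fact k * exp ((pi * R + 2)\<^sup>2 / (pi * \<delta>))"

lemma norm_theta_term_le:
  assumes "\<delta> > 0" "Im \<tau> \<ge> \<delta>" "norm z \<le> R"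
  shows "norm (theta_term k \<tau> z n) \<le> theta_bound k \<delta> R * exp (- \<bar>real_of_int n\<bar>)"
proof -
  define t where "t = \<bar>real_of_int n\<bar>"
  have t: "t \<ge> 0" "t\<^sup>2 = real_of_int n ^ 2" by (auto simp: t_def)
  have R: "R \<ge> 0" using assms(3) norm_ge_zero order_trans by blast
  have "\<bar>real_of_int n * Im z\<bar> \<le> t * R"
    unfolding abs_mult t_def using assms(3) abs_Im_le_cmod[of z]
    by (intro mult_left_mono) auto
  then have a: "- (real_of_int n * Im z) \<le> t * R" by linarith
  have "Re (2 * pi * \<i> * (of_int n ^ 2 / 8 * \<tau> + of_int n / 2 * z)) =
     - (pi * (t\<^sup>2 * Im \<tau>) / 4) + pi * (- (real_of_int n * Im z))"
    by (simp add: t(2) Re_power2 Im_power2 algebra_simps)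
  also have "\<dots> \<le> - (pi * (t\<^sup>2 * \<delta>) / 4) + pi * (t * R)"
    using a assms(2) by (intro add_mono mult_left_mono le_imp_neg_le divide_right_mono) auto
  also have "\<dots> \<le> (pi * R + 2)\<^sup>2 / (pi * \<delta>) - 2 * t"
  proof -
    have "0 \<le> (pi * \<delta> * t / 2 - (pi * R + 2))\<^sup>2" by simp
    then have "(pi * R + 2)* (pi * \<delta> * t) \<le> pi\<^sup>2 * \<delta>\<^sup>2 * t\<^sup>2 / 4 + (pi * R + 2)\<^sup>2"
      by (simp add: power2_eq_square algebra_simps)
    then have "(pi * R + 2) * t \<le> pi * \<delta> * t\<^sup>2 / 4 + (pi * R + 2)\<^sup>2 / (pi * \<delta>)"
      using assms(1) by (simp add: field_simps power2_eq_square)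
    then show ?thesis by (simp add: algebra_simps)
  qed
  finally have b: "Re (2 * pi * \<i> * (of_int n ^ 2 / 8 * \<tau> + of_int n / 2 * z)) \<le>
      (pi * R + 2)\<^sup>2 / (pi * \<delta>) - 2 * t" .
  have c: "norm (of_int (chi4 n) :: complex) \<le> 1"
    using abs_chi4_le[of n] by (metis norm_of_int of_int_1_le_iff of_int_le_1_iff of_int_abs)
  have "norm (theta_term k \<tau> z n) = norm (of_int (chi4 n) :: complex) * t ^ k *
      exp (Re (2 * pi * \<i> * (of_int n ^ 2 / 8 * \<tau> + of_int n / 2 * z)))"
    by (simp only: theta_term_def norm_mult norm_power norm_exp_eq_Re norm_of_int t_def)
  also have "\<dots> \<le> 1 * (fact k * exp t) * exp ((pi * R + 2)\<^sup>2 / (pi * \<delta>) - 2 * t)"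
    using c power_le_fact_exp[OF t(1), of k] b t(1) by (intro mult_mono) auto
  also have "\<dots> = theta_bound k \<delta> R * exp (- t)"
    by (simp add: theta_bound_def exp_diff exp_minus field_simps flip: exp_add)
  finally show ?thesis by (simp add: t_def)
qed

lemma theta_term_abs_summable:
  assumes "Im \<tau> > 0"
  shows "(\<lambda>n. norm (theta_term k \<tau> z n)) summable_on UNIV"
proof (rule Infinite_Sum.abs_summable_on_comparison_test')
  show "(\<lambda>n::int. theta_bound k (Im \<tau>) (norm z) * exp (- \<bar>real_of_int n\<bar>)) summable_on UNIV"
    by (intro summable_on_cmult_right summable_exp_minus_abs_int)
  show "norm (theta_term k \<tau> z n) \<le> theta_bound k (Im \<tau>) (norm z) * exp (- \<bar>real_of_int n\<bar>)" for n
    by (rule norm_theta_term_le) (use assms in auto)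
qed

lemma theta_term_has_sum:
  assumes "Im \<tau> > 0"
  shows "(theta_term k \<tau> z has_sum theta_moment k \<tau> z) UNIV"
  unfolding theta_moment_def
  using theta_term_abs_summable[OF assms] abs_summable_summable has_sum_infsum by blast

lemma has_sum_int_decode_iff:
  "((\<lambda>i. f (int_decode i)) has_sum s) UNIV \<longleftrightarrow> (f has_sum s) UNIV"
  using has_sum_reindex_bij_betw[OF bij_int_decode] .

lemma theta_term_sums:
  assumes "Im \<tau> > 0"
  shows "(\<lambda>i. theta_term k \<tau> z (int_decode i)) sums theta_moment k \<tau> z"
  using theta_term_has_sum[OF assms, of k z] has_sum_int_decode_iff[of "theta_term k \<tau> z"]
  by (intro has_sum_imp_sums) blast

lemma theta_moment_uniform_limit:
  assumes "\<delta> > 0"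
  shows "uniform_limit ({\<tau>. Im \<tau> > \<delta>} \<times> ball 0 R)
     (\<lambda>n (\<tau>, z). \<Sum>i<n. theta_term k \<tau> z (int_decode i)) (\<lambda>(\<tau>, z). theta_moment k \<tau> z) sequentially"
proof -
  have s: "summable (\<lambda>i. theta_bound k \<delta> R * exp (- \<bar>real_of_int (int_decode i)\<bar>))"
  proof (intro summable_mult summable_on_imp_summable)
    show "(\<lambda>i. exp (- \<bar>real_of_int (int_decode i)\<bar>)) summable_on UNIV"
      using summable_on_reindex_bij_betw[OF bij_int_decode, of "\<lambda>n. exp (- \<bar>real_of_int n\<bar>)"]
        summable_exp_minus_abs_int by simp
  qed
  have "uniform_limit ({\<tau>. Im \<tau> > \<delta>} \<times> ball 0 R)
     (\<lambda>n x. \<Sum>i<n. theta_term k (fst x) (snd x) (int_decode i))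
     (\<lambda>x. \<Sum>i. theta_term k (fst x) (snd x) (int_decode i)) sequentially"
    by (rule Weierstrass_m_test[OF _ s]) (use assms in \<open>auto intro!: norm_theta_term_le\<close>)
  then show ?thesis
    by (rule uniform_limit_cong'[THEN iffD1, rotated -1])
      (use theta_term_sums assms in \<open>auto simp: sums_iff case_prod_beta\<close>)
qed

text \<open>The joint derivative in \<open>(\<tau>, z)\<close>. Its two components express the heat equation
  \<open>\<partial>\<^sub>z\<^sup>2 = 4\<pi>i \<partial>\<^sub>\<tau>\<close>, which later ties the third Taylor coefficient of \<open>\<vartheta>\<close> in \<open>z\<close> to the
  \<open>\<tau>\<close>-derivative of the first.\<close>

lemma theta_moment_has_derivative:
  assumes "Im \<tau> > 0"
  shows "((\<lambda>(\<tau>, z). theta_moment k \<tau> z) has_derivative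
     (\<lambda>(h, w). pi * \<i> / 4 * theta_moment (k + 2) \<tau> z * h + pi * \<i> * theta_moment (k + 1) \<tau> z * w))
     (at (\<tau>, z))"
proof -
  define \<delta> where "\<delta> = Im \<tau> / 2"
  define R where "R = norm z + 1"
  define S where "S = {\<tau>. Im \<tau> > \<delta>} \<times> ball (0::complex) R"
  have \<delta>: "\<delta> > 0" using assms by (simp add: \<delta>_def)
  have x0: "(\<tau>, z) \<in> S" using assms by (simp add: S_def \<delta>_def R_def)
  have cv: "convex S" unfolding S_def
    by (intro convex_Times convex_halfspace_Im_gt convex_ball)
  have op: "open S" unfolding S_def
    by (intro open_Times open_halfspace_Im_gt open_ball)
  define f where "f i x = theta_term k (fst x) (snd x) (int_decode i)" for i x
  define f' where "f' i x h = pi * \<i> / 4 * theta_term (k + 2) (fst x) (snd x) (int_decode i) * fst h +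
     pi * \<i> * theta_term (k + 1) (fst x) (snd x) (int_decode i) * snd h" for i and x h :: "complex \<times> complex"
  define g' where "g' x h = pi * \<i> / 4 * theta_moment (k + 2) (fst x) (snd x) * fst h +
     pi * \<i> * theta_moment (k + 1) (fst x) (snd x) * snd h" for x h :: "complex \<times> complex"
  have d: "(f i has_derivative f' i x) (at x within S)" for i x
  proof -
    define n where "n = int_decode i"
    define E where "E x = 2 * pi * \<i> * (of_int n ^ 2 / 8 * fst x + of_int n / 2 * snd x)"
      for x :: "complex \<times> complex"
    have bl: "bounded_linear E"
      unfolding E_def by (intro bounded_linear_mult_right bounded_linear_add bounded_linear_const_mult
          bounded_linear_fst bounded_linear_snd)
    have "((\<lambda>x. of_int (chi4 n) * of_int n ^ k * exp (E x)) has_derivative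
       (\<lambda>h. of_int (chi4 n) * of_int n ^ k * (exp (E x) * E h))) (at x within S)"
      using has_derivative_compose[OF bounded_linear_imp_has_derivative[OF bl]
          DERIV_exp[unfolded has_field_derivative_def]]
      by (rule has_derivative_mult_right)
    also have "(\<lambda>h. of_int (chi4 n) * of_int n ^ k * (exp (E x) * E h)) = f' i x"
      by (simp add: fun_eq_iff f'_def theta_term_def n_def E_def power2_eq_square algebra_simps)
    also have "(\<lambda>x. of_int (chi4 n) * of_int n ^ k * exp (E x)) = f i"
      by (simp add: fun_eq_iff f_def theta_term_def n_def E_def)
    finally show ?thesis .
  qed
  have tail: "\<forall>\<^sub>F n in sequentially. \<forall>x\<in>S. \<forall>h. norm ((\<Sum>i<n. f' i x h) - g' x h) \<le> e * norm h"
    if "e > 0" for e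
  proof -
    have e: "e / 8 > 0" using that by simp
    have l: "\<forall>\<^sub>F n in sequentially. \<forall>x\<in>S.
        norm ((\<Sum>i<n. theta_term m (fst x) (snd x) (int_decode i)) - theta_moment m (fst x) (snd x)) < e / 8" for m
      using uniform_limitD[OF theta_moment_uniform_limit[OF \<delta>, where k = m and R = R] e]
      by (simp add: S_def dist_norm case_prod_beta)
    from l[of "k + 2"] l[of "k + 1"] show ?thesis
    proof eventually_elim
      case (elim n)
      show ?case
      proof (intro ballI allI)
        fix x h assume x: "x \<in> S"
        define A where "A = (\<Sum>i<n. theta_term (k+2) (fst x) (snd x) (int_decode i)) - theta_moment (k+2) (fst x) (snd x)"
        define B where "B = (\<Sum>i<n. theta_term (k+1) (fst x) (snd x) (int_decode i)) - theta_moment (k+1) (fst x) (snd x)"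
        have AB: "norm A \<le> e / 8" "norm B \<le> e / 8" using elim x by (auto simp: A_def B_def less_imp_le)
        have "(\<Sum>i<n. f' i x h) - g' x h = pi * \<i> / 4 * A * fst h + pi * \<i> * B * snd h"
          unfolding f'_def g'_def A_def B_def sum.distrib
            sum_distrib_left[symmetric] sum_distrib_right[symmetric]
          by (simp only: algebra_simps)
        then have "norm ((\<Sum>i<n. f' i x h) - g' x h) \<le>
            norm (pi * \<i> / 4 * A * fst h) + norm (pi * \<i> * B * snd h)"
          by (simp only: norm_triangle_ineq)
        also have "\<dots> = pi / 4 * norm A * norm (fst h) + pi * norm B * norm (snd h)"
          by (simp add: norm_mult)
        also have "\<dots> \<le> 1 * (e / 8) * norm h + 4 * (e / 8) * norm h"
        proof (intro add_mono mult_mono)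
          show "norm (fst h) \<le> norm h" "norm (snd h) \<le> norm h"
            by (metis norm_fst_le prod.collapse, metis norm_snd_le prod.collapse)
          show "pi / 4 \<le> 1" "pi \<le> 4" using pi_less_4 by auto
        qed (use AB that in auto)
        also have "\<dots> \<le> e * norm h" using that by simp
        finally show "norm ((\<Sum>i<n. f' i x h) - g' x h) \<le> e * norm h" .
      qed
    qed
  qed
  have "(\<lambda>i. f i (\<tau>, z)) sums theta_moment k \<tau> z"
    using theta_term_sums[OF assms] by (simp add: f_def)
  from has_derivative_series[OF cv d tail x0 this]
  obtain g where g: "\<And>x. x \<in> S \<Longrightarrow> (\<lambda>i. f i x) sums g x"
      "\<And>x. x \<in> S \<Longrightarrow> (g has_derivative g' x) (at x within S)" by blast
  have geq: "g x = (\<lambda>(\<tau>, z). theta_moment k \<tau> z) x" if "x \<in> S" for x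
  proof -
    have "Im (fst x) > 0" using that \<delta> by (auto simp: S_def)
    then show ?thesis using g(1)[OF that] theta_term_sums[of "fst x" k "snd x"]
      by (simp add: f_def case_prod_beta sums_unique2)
  qed
  have "((\<lambda>(\<tau>, z). theta_moment k \<tau> z) has_derivative g' (\<tau>, z)) (at (\<tau>, z) within S)"
    using has_derivative_transform[OF x0 _ g(2)[OF x0]] geq by metis
  then have "((\<lambda>(\<tau>, z). theta_moment k \<tau> z) has_derivative g' (\<tau>, z)) (at (\<tau>, z))"
    using op x0 at_within_open by metis
  moreover have "g' (\<tau>, z) = (\<lambda>(h, w). pi * \<i> / 4 * theta_moment (k + 2) \<tau> z * h + pi * \<i> * theta_moment (k + 1) \<tau> z * w)"
    by (simp add: g'_def fun_eq_iff)
  ultimately show ?thesis by simp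
qed

lemma theta_moment_has_field_derivative_z:
  assumes "Im \<tau> > 0"
  shows "(theta_moment k \<tau> has_field_derivative pi * \<i> * theta_moment (Suc k) \<tau> z) (at z)"
proof -
  have "((\<lambda>z. (\<tau>, z)) has_derivative (\<lambda>w. (0, w))) (at z)"
    by (auto intro!: derivative_eq_intros)
  from has_derivative_compose[OF this theta_moment_has_derivative[OF assms, of k z]]
  show ?thesis by (simp add: has_field_derivative_def)
qed

lemma theta_moment_has_field_derivative_tau:
  assumes "Im \<tau> > 0"
  shows "((\<lambda>\<tau>. theta_moment k \<tau> z) has_field_derivative pi * \<i> / 4 * theta_moment (k + 2) \<tau> z) (at \<tau>)"
proof -
  have "((\<lambda>\<tau>. (\<tau>, z)) has_derivative (\<lambda>w. (w, 0))) (at \<tau>)"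
    by (auto intro!: derivative_eq_intros)
  from has_derivative_compose[OF this theta_moment_has_derivative[OF assms, of k z]]
  have "((\<lambda>\<tau>. theta_moment k \<tau> z) has_derivative
      (\<lambda>w. pi * \<i> / 4 * theta_moment (k + 2) \<tau> z * w)) (at \<tau>)"
    by simp
  then show ?thesis unfolding has_field_derivative_def .
qed

section \<open>Quasi-periodicity\<close>

lemma chi4_add_2: "chi4 (n + 2) = - chi4 n"
  unfolding chi4_def by presburger

lemma chi4_uminus: "chi4 (- n) = - chi4 n"
  unfolding chi4_def by presburger

lemma chi4_even: "even n \<Longrightarrow> chi4 n = 0"
  unfolding chi4_def by presburger

lemma chi4_odd: "chi4 (2 * m + 1) = (if even m then 1 else - 1)"
  unfolding chi4_def by presburger

lemma theta_uminus: "theta \<tau> (- z) = - theta \<tau> z"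
proof -
  have "theta \<tau> (- z) = (\<Sum>\<^sub>\<infinity>n\<in>UNIV. - theta_term 0 \<tau> z (- n))"
    by (simp add: theta_eq_moment theta_moment_def theta_term_def chi4_uminus)
  also have "\<dots> = - (\<Sum>\<^sub>\<infinity>n\<in>UNIV. theta_term 0 \<tau> z (- n))"
    by (rule infsum_uminus)
  also have "(\<Sum>\<^sub>\<infinity>n\<in>UNIV. theta_term 0 \<tau> z (- n)) = (\<Sum>\<^sub>\<infinity>n\<in>UNIV. theta_term 0 \<tau> z n)"
    by (rule infsum_reindex_bij_betw) (auto intro!: bij_uminus)
  finally show ?thesis by (simp add: theta_eq_moment theta_moment_def)
qed

lemma theta_add_1: "theta \<tau> (z + 1) = - theta \<tau> z"
proof -
  have "theta_term 0 \<tau> (z + 1) n = - theta_term 0 \<tau> z n" for n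
  proof (cases "even n")
    case False
    then obtain m where m: "n = 2 * m + 1" by (elim oddE)
    have "exp (2 * pi * \<i> * (of_int n ^ 2 / 8 * \<tau> + of_int n / 2 * (z + 1))) =
        exp (2 * pi * \<i> * (of_int n ^ 2 / 8 * \<tau> + of_int n / 2 * z)) * exp (of_int n * (pi * \<i>))"
      unfolding exp_add[symmetric] by (rule arg_cong[where f = exp]) (simp add: field_simps)
    also have "exp (of_int n * (pi * \<i>)) = exp (pi * \<i>) * exp (2 * of_int m * pi * \<i>)"
      by (simp add: exp_add[symmetric] m algebra_simps)
    also have "exp (2 * of_int m * pi * \<i>) = 1"
      by (rule exp_integer_2pi) auto
    finally show ?thesis by (simp add: theta_term_def)
  qed (simp add: theta_term_def chi4_even)
  then show ?thesis
    by (simp add: theta_eq_moment theta_moment_def infsum_uminus)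
qed

lemma theta_add_tau: "theta \<tau> (z + \<tau>) = - exp (- pi * \<i> * (\<tau> + 2 * z)) * theta \<tau> z"
proof -
  have "theta_term 0 \<tau> (z + \<tau>) n = - exp (- pi * \<i> * (\<tau> + 2 * z)) * theta_term 0 \<tau> z (n + 2)" for n
  proof -
    have "exp (2 * pi * \<i> * (of_int n ^ 2 / 8 * \<tau> + of_int n / 2 * (z + \<tau>))) =
      exp (- pi * \<i> * (\<tau> + 2 * z)) * exp (2 * pi * \<i> * (of_int (n + 2) ^ 2 / 8 * \<tau> + of_int (n + 2) / 2 * z))"
      unfolding exp_add[symmetric]
      by (rule arg_cong[where f = exp]) (simp add: field_simps power2_eq_square)
    then show ?thesis by (simp only: theta_term_def chi4_add_2) simp
  qed
  then have "theta \<tau> (z + \<tau>) = (\<Sum>\<^sub>\<infinity>n. - exp (- pi * \<i> * (\<tau> + 2 * z)) * theta_term 0 \<tau> z (n + 2))"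
    by (simp add: theta_eq_moment theta_moment_def)
  also have "\<dots> = - exp (- pi * \<i> * (\<tau> + 2 * z)) * (\<Sum>\<^sub>\<infinity>n. theta_term 0 \<tau> z (n + 2))"
    by (rule infsum_cmult_right')
  also have "(\<Sum>\<^sub>\<infinity>n. theta_term 0 \<tau> z (n + 2)) = (\<Sum>\<^sub>\<infinity>n. theta_term 0 \<tau> z n)"
    by (rule infsum_reindex_bij_betw) (auto intro!: bij_betwI[where g = "\<lambda>n. n - 2"])
  finally show ?thesis by (simp add: theta_eq_moment theta_moment_def)
qed

lemma theta_add_int: "theta \<tau> (z + of_int n) = (-1) powi n * theta \<tau> z"
proof (induction n rule: int_induct[where k = 0])
  case (step1 i)
  have "theta \<tau> (z + of_int (i + 1)) = theta \<tau> ((z + of_int i) + 1)" by (simp add: algebra_simps)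
  then show ?case using step1 by (simp only: theta_add_1) (simp add: power_int_add)
next
  case (step2 i)
  have "theta \<tau> (z + of_int i) = theta \<tau> ((z + of_int (i - 1)) + 1)" by (simp add: algebra_simps)
  then show ?case using step2 by (simp only: theta_add_1) (simp add: power_int_diff)
qed simp

lemma theta_add_int_tau:
  "theta \<tau> (z + of_int m * \<tau>) =
     (-1) powi m * exp (- pi * \<i> * (of_int m ^ 2 * \<tau> + 2 * of_int m * z)) * theta \<tau> z"
proof (induction m rule: int_induct[where k = 0])
  case (step1 i)
  have "theta \<tau> (z + of_int (i + 1) * \<tau>) = theta \<tau> ((z + of_int i * \<tau>) + \<tau>)" by (simp add: algebra_simps)
  also have "\<dots> = - exp (- pi * \<i> * (\<tau> + 2 * (z + of_int i * \<tau>))) * ((-1) powi i * exp (- pi * \<i> * (of_int i ^ 2 * \<tau> + 2 * of_int i * z)) * theta \<tau> z)"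
    using step1 by (simp only: theta_add_tau)
  also have "\<dots> = (-1) powi (i + 1) * (exp (- pi * \<i> * (\<tau> + 2 * (z + of_int i * \<tau>))) * exp (- pi * \<i> * (of_int i ^ 2 * \<tau> + 2 * of_int i * z))) * theta \<tau> z"
    by (simp add: power_int_add)
  also have "exp (- pi * \<i> * (\<tau> + 2 * (z + of_int i * \<tau>))) * exp (- pi * \<i> * (of_int i ^ 2 * \<tau> + 2 * of_int i * z)) =
     exp (- pi * \<i> * (of_int (i+1) ^ 2 * \<tau> + 2 * of_int (i+1) * z))"
    by (simp add: exp_add[symmetric] power2_eq_square algebra_simps)
  finally show ?case .
next
  case (step2 i)
  have e: "exp (- pi * \<i> * (of_int i ^ 2 * \<tau> + 2 * of_int i * z)) =
     exp (- pi * \<i> * (of_int (i-1) ^ 2 * \<tau> + 2 * of_int (i-1) * z)) * exp (- pi * \<i> * (\<tau> + 2 * (z + of_int (i - 1) * \<tau>)))"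
    by (simp add: exp_add[symmetric] power2_eq_square algebra_simps)
  have "theta \<tau> (z + of_int i * \<tau>) = theta \<tau> ((z + of_int (i - 1) * \<tau>) + \<tau>)" by (simp add: algebra_simps)
  then have "(-1) powi i * exp (- pi * \<i> * (of_int i ^ 2 * \<tau> + 2 * of_int i * z)) * theta \<tau> z =
     - exp (- pi * \<i> * (\<tau> + 2 * (z + of_int (i - 1) * \<tau>))) * theta \<tau> (z + of_int (i - 1) * \<tau>)"
    using step2 by (simp only: theta_add_tau)
  then have "exp (- pi * \<i> * (\<tau> + 2 * (z + of_int (i - 1) * \<tau>))) * theta \<tau> (z + of_int (i - 1) * \<tau>) =
     exp (- pi * \<i> * (\<tau> + 2 * (z + of_int (i - 1) * \<tau>))) *
       ((-1) powi (i - 1) * exp (- pi * \<i> * (of_int (i-1) ^ 2 * \<tau> + 2 * of_int (i-1) * z)) * theta \<tau> z)"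
    unfolding e by (simp add: power_int_diff mult_ac)
  then show ?case by (simp only: mult_left_cancel[OF exp_not_eq_zero])
qed simp

lemma theta_add_lattice:
  "theta \<tau> (z + of_int m * \<tau> + of_int n) =
     (-1) powi (m + n) * exp (- pi * \<i> * (of_int m ^ 2 * \<tau> + 2 * of_int m * z)) * theta \<tau> z"
  by (simp add: theta_add_int theta_add_int_tau power_int_add)

section \<open>q-Pochhammer products\<close>

text \<open>The finite product \<open>(y; q)\<^sub>n\<close> and its limit \<open>(y; q)\<^sub>\<infinity>\<close>.\<close>

definition qpoch :: "complex \<Rightarrow> complex \<Rightarrow> nat \<Rightarrow> complex" where
  "qpoch y q n = (\<Prod>k<n. 1 - y * q ^ k)"

definition qpoch_inf :: "complex \<Rightarrow> complex \<Rightarrow> complex" where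
  "qpoch_inf y q = (\<Prod>k. 1 - y * q ^ k)"

lemma convergent_prod_qpoch:
  fixes q y :: complex
  assumes "norm q < 1"
  shows "convergent_prod (\<lambda>k. 1 - y * q ^ k)"
proof (intro abs_convergent_prod_imp_convergent_prod summable_imp_abs_convergent_prod)
  show "summable (\<lambda>i. norm (1 - y * q ^ i - 1))"
    using assms by (auto simp: norm_mult norm_power intro!: summable_mult summable_geometric)
qed

lemma qpoch_LIMSEQ:
  assumes "norm q < 1"
  shows "qpoch y q \<longlonglongrightarrow> qpoch_inf y q"
  using convergent_prod_LIMSEQ[OF convergent_prod_qpoch[OF assms, of y]]
  unfolding qpoch_inf_def lessThan_Suc_atMost[symmetric]
  by (subst filterlim_sequentially_Suc[symmetric]) (simp add: qpoch_def[abs_def])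

lemma qpoch_inf_nonzero:
  assumes "norm q < 1" "\<And>k. y * q ^ k \<noteq> 1"
  shows "qpoch_inf y q \<noteq> 0"
  unfolding qpoch_inf_def
  by (rule prodinf_nonzero[OF convergent_prod_qpoch[OF assms(1)]]) (use assms(2) in auto)

lemma qpoch_inf_split_head:
  assumes "norm q < 1"
  shows "qpoch_inf y q = (1 - y) * qpoch_inf (y * q) q"
proof (rule LIMSEQ_unique)
  have "(\<lambda>n. (1 - y) * qpoch (y * q) q n) \<longlonglongrightarrow> (1 - y) * qpoch_inf (y * q) q"
    by (intro tendsto_mult tendsto_const qpoch_LIMSEQ assms)
  moreover have "(1 - y) * qpoch (y * q) q n = qpoch y q (Suc n)" for n
    unfolding qpoch_def prod.lessThan_Suc_shift by (simp add: mult_ac)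
  ultimately show "(\<lambda>n. qpoch y q (Suc n)) \<longlonglongrightarrow> (1 - y) * qpoch_inf (y * q) q" by simp
  show "(\<lambda>n. qpoch y q (Suc n)) \<longlonglongrightarrow> qpoch_inf y q"
    using qpoch_LIMSEQ[OF assms] by (rule LIMSEQ_Suc)
qed

text \<open>Locally uniform absolute convergence makes an infinite product holomorphic.\<close>

lemma holomorphic_on_prodinf:
  fixes f :: "nat \<Rightarrow> complex \<Rightarrow> complex"
  assumes S: "open S" and hol: "\<And>n. f n holomorphic_on S"
    and bound: "\<And>x. x \<in> S \<Longrightarrow> \<exists>d M. d > 0 \<and> cball x d \<subseteq> S \<and> summable M \<and>
      (\<forall>n. \<forall>y\<in>cball x d. norm (f n y - 1) \<le> M n)"
  shows "(\<lambda>x. \<Prod>n. f n x) holomorphic_on S"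
proof (rule holomorphic_uniform_sequence[OF S])
  show "(\<lambda>x. \<Prod>k<n. f k x) holomorphic_on S" for n
    by (intro holomorphic_intros hol)
  fix x assume "x \<in> S"
  then obtain d M where dM: "d > 0" "cball x d \<subseteq> S" "summable M"
      "\<And>n y. y \<in> cball x d \<Longrightarrow> norm (f n y - 1) \<le> M n"
    using bound by meson
  have "uniformly_convergent_on (cball x d) (\<lambda>N y. \<Sum>n<N. norm (f n y - 1))"
    unfolding uniformly_convergent_on_def
    by (rule exI, rule Weierstrass_m_test[OF _ dM(3)]) (use dM(4) in auto)
  then have "uniformly_convergent_on (cball x d) (\<lambda>N y. \<Prod>n<N. f n y)"
    by (intro uniformly_convergent_on_prod')
      (auto intro!: holomorphic_on_imp_continuous_on holomorphic_on_subset[OF hol] dM(2))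
  then obtain l where l: "uniform_limit (cball x d) (\<lambda>N y. \<Prod>n<N. f n y) l sequentially"
    unfolding uniformly_convergent_on_def by blast
  have eq: "l y = (\<Prod>n. f n y)" if "y \<in> cball x d" for y
  proof (rule LIMSEQ_unique)
    have "summable (\<lambda>n. norm (f n y - 1))"
      using dM(3,4) that by (intro summable_comparison_test[OF _ dM(3)]) auto
    then have "convergent_prod (\<lambda>n. f n y)"
      by (intro abs_convergent_prod_imp_convergent_prod summable_imp_abs_convergent_prod)
    from convergent_prod_LIMSEQ[OF this]
    show "(\<lambda>N. \<Prod>n<Suc N. f n y) \<longlonglongrightarrow> (\<Prod>n. f n y)"
      unfolding lessThan_Suc_atMost .
    show "(\<lambda>N. \<Prod>n<Suc N. f n y) \<longlonglongrightarrow> l y"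
      using LIMSEQ_Suc[OF tendsto_uniform_limitI[OF l that]] .
  qed
  have "uniform_limit (cball x d) (\<lambda>N y. \<Prod>n<N. f n y) (\<lambda>y. \<Prod>n. f n y) sequentially"
    using l by (rule uniform_limit_cong'[THEN iffD1, rotated -1]) (use eq in auto)
  with dM show "\<exists>d>0. cball x d \<subseteq> S \<and>
      uniform_limit (cball x d) (\<lambda>n x. \<Prod>k<n. f k x) (\<lambda>x. \<Prod>n. f n x) sequentially"
    by blast
qed

lemma qpoch_inf_holomorphic:
  assumes "norm q < 1"
  shows "(\<lambda>y. qpoch_inf y q) holomorphic_on UNIV"
  unfolding qpoch_inf_def
proof (rule holomorphic_on_prodinf)
  fix x :: complex
  have "summable (\<lambda>n. (norm x + 1) * norm q ^ n)"
    using assms by (intro summable_mult summable_geometric) auto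
  moreover have "norm (1 - y * q ^ n - 1) \<le> (norm x + 1) * norm q ^ n" if "y \<in> cball x 1" for n y
  proof -
    have "norm y \<le> norm x + 1"
      using that norm_triangle_ineq3[of y x] by (auto simp: dist_norm norm_minus_commute)
    then show ?thesis by (simp add: norm_mult norm_power mult_right_mono)
  qed
  ultimately show "\<exists>d M. d > 0 \<and> cball x d \<subseteq> UNIV \<and> summable M \<and>
      (\<forall>n. \<forall>y\<in>cball x d. norm (1 - y * q ^ n - 1) \<le> M n)"
    by (intro exI[of _ 1] exI[of _ "\<lambda>n. (norm x + 1) * norm q ^ n"]) auto
qed (auto intro!: holomorphic_intros)

lemma qpoch_inf_diag_holomorphic: "(\<lambda>q. qpoch_inf q q) holomorphic_on ball 0 1"
  unfolding qpoch_inf_def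
proof (rule holomorphic_on_prodinf)
  fix x :: complex assume x: "x \<in> ball 0 1"
  define r where "r = (1 + norm x) / 2"
  have r: "norm x < r" "r < 1" "r \<ge> 0" using x by (auto simp: r_def add_nonneg_nonneg)
  have "summable (\<lambda>n. r * r ^ n)"
    using r by (intro summable_mult summable_geometric) auto
  moreover have "norm (1 - y * y ^ n - 1) \<le> r * r ^ n" and "norm y < 1" if "y \<in> cball x (r - norm x)" for n y
  proof -
    have "norm y \<le> r"
      using that norm_triangle_ineq3[of y x] by (auto simp: dist_norm norm_minus_commute)
    then show "norm (1 - y * y ^ n - 1) \<le> r * r ^ n" "norm y < 1"
      using r by (auto simp: norm_mult norm_power intro!: mult_mono power_mono)
  qed
  ultimately show "\<exists>d M. d > 0 \<and> cball x d \<subseteq> ball 0 1 \<and> summable M \<and>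
      (\<forall>n. \<forall>y\<in>cball x d. norm (1 - y * y ^ n - 1) \<le> M n)"
    using r by (intro exI[of _ "r - norm x"] exI[of _ "\<lambda>n. r * r ^ n"]) auto
qed (auto intro!: holomorphic_intros)

lemma power_Suc_neq_1: "norm q < 1 \<Longrightarrow> q * q ^ k \<noteq> (1::complex)"
proof
  assume "norm q < 1" "q * q ^ k = 1"
  then have "norm q ^ Suc k = 1" by (metis norm_one norm_power power_Suc)
  moreover have "norm q ^ Suc k < 1" using \<open>norm q < 1\<close> by (simp add: power_less_one_iff del: power_Suc)
  ultimately show False by simp
qed

lemma qpoch_inf_diag_nonzero: "norm q < 1 \<Longrightarrow> qpoch_inf q q \<noteq> 0"
  by (rule qpoch_inf_nonzero) (auto dest: power_Suc_neq_1)

lemma qpoch_diag_nonzero: "norm q < 1 \<Longrightarrow> qpoch q q n \<noteq> 0"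
  by (auto simp: qpoch_def dest: power_Suc_neq_1)

section \<open>The Jacobi triple product\<close>

text \<open>The Gaussian binomial coefficient, by the \<open>q\<close>-Pascal rule.\<close>

fun gauss_binomial :: "complex \<Rightarrow> nat \<Rightarrow> nat \<Rightarrow> complex" where
  "gauss_binomial q n 0 = 1"
| "gauss_binomial q 0 (Suc k) = 0"
| "gauss_binomial q (Suc n) (Suc k) = q ^ Suc k * gauss_binomial q n (Suc k) + gauss_binomial q n k"

lemma gauss_binomial_eq_0: "n < k \<Longrightarrow> gauss_binomial q n k = 0"
  by (induction q n k rule: gauss_binomial.induct) auto

lemma gauss_binomial_self: "gauss_binomial q n n = 1"
  by (induction n) (auto simp: gauss_binomial_eq_0)

lemma q_binomial_theorem:
  "(\<Prod>k<n. 1 + x * q ^ k) = (\<Sum>k\<le>n. q ^ (k choose 2) * gauss_binomial q n k * x ^ k)"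
proof (induction n arbitrary: x)
  case (Suc n)
  have c2: "Suc k choose 2 = k + (k choose 2)" for k by (simp add: numeral_2_eq_2)
  have "(\<Prod>k<Suc n. 1 + x * q ^ k) = (1 + x) * (\<Prod>k<n. 1 + (x * q) * q ^ k)"
    by (simp only: prod.lessThan_Suc_shift) (simp add: mult_ac)
  also have "\<dots> = (1 + x) * (\<Sum>k\<le>n. q ^ (k choose 2) * gauss_binomial q n k * (x * q) ^ k)"
    by (simp only: Suc)
  also have "\<dots> = (\<Sum>k\<le>n. q ^ (k choose 2) * gauss_binomial q n k * (x * q) ^ k) +
      (\<Sum>k\<le>n. q ^ (Suc k choose 2) * gauss_binomial q n k * x ^ Suc k)"
    by (simp add: c2 distrib_right sum.distrib sum_distrib_left power_mult_distrib power_add mult_ac)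
  also have "(\<Sum>k\<le>n. q ^ (k choose 2) * gauss_binomial q n k * (x * q) ^ k) =
      (\<Sum>k\<le>Suc n. q ^ (k choose 2) * gauss_binomial q n k * (x * q) ^ k)"
    by (simp add: gauss_binomial_eq_0)
  also have "\<dots> = 1 + (\<Sum>k\<le>n. q ^ (Suc k choose 2) * (q ^ Suc k * gauss_binomial q n (Suc k)) * x ^ Suc k)"
    by (subst sum.atMost_Suc_shift) (simp add: power_mult_distrib numeral_2_eq_2 mult_ac)
  also have "\<dots> + (\<Sum>k\<le>n. q ^ (Suc k choose 2) * gauss_binomial q n k * x ^ Suc k) =
      1 + (\<Sum>k\<le>n. q ^ (Suc k choose 2) * gauss_binomial q (Suc n) (Suc k) * x ^ Suc k)"
    by (simp add: sum.distrib[symmetric] algebra_simps)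
  also have "\<dots> = (\<Sum>k\<le>Suc n. q ^ (k choose 2) * gauss_binomial q (Suc n) k * x ^ k)"
    by (subst sum.atMost_Suc_shift) (simp add: numeral_2_eq_2)
  finally show ?case .
qed (simp add: numeral_2_eq_2)

lemma qpoch_Suc: "qpoch y q (Suc n) = qpoch y q n * (1 - y * q ^ n)"
  by (simp add: qpoch_def)

lemma gauss_binomial_mult_qpoch:
  "gauss_binomial q (n + k) k * (qpoch q q k * qpoch q q n) = qpoch q q (n + k)"
proof (induction "n + k" arbitrary: n k)
  case 0
  then show ?case by (simp add: qpoch_def)
next
  case (Suc N)
  consider "k = 0" | k' where "k = Suc k'" "n = 0" | k' n' where "k = Suc k'" "n = Suc n'"
    by (metis not0_implies_Suc)
  then show ?case
  proof cases
    case 1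
    then show ?thesis by (simp add: qpoch_def)
  next
    case (2 k')
    then show ?thesis
      by (simp add: gauss_binomial_self) (simp add: qpoch_def)
  next
    case (3 k' n')
    have i1: "gauss_binomial q (n' + k) k * (qpoch q q k * qpoch q q n') = qpoch q q (n' + k)"
      by (rule Suc(1)) (use Suc(2) 3 in simp)
    have i2: "gauss_binomial q (n + k') k' * (qpoch q q k' * qpoch q q n) = qpoch q q (n + k')"
      by (rule Suc(1)) (use Suc(2) 3 in simp)
    have N: "n' + k = n + k'" "n + k = Suc (n + k')" using 3 by auto
    have "gauss_binomial q (n + k) k * (qpoch q q k * qpoch q q n) =
        q ^ Suc k' * (1 - q * q ^ n') * (gauss_binomial q (n' + k) k * (qpoch q q k * qpoch q q n')) +
        (1 - q * q ^ k') * (gauss_binomial q (n + k') k' * (qpoch q q k' * qpoch q q n))"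
      by (simp add: 3 qpoch_Suc algebra_simps)
    also have "\<dots> = (q ^ Suc k' * (1 - q * q ^ n') + (1 - q * q ^ k')) * qpoch q q (n + k')"
      by (simp only: i1[unfolded N(1)] i2 N(1) distrib_right)
    also have "q ^ Suc k' * (1 - q * q ^ n') + (1 - q * q ^ k') = 1 - q * q ^ (n + k')"
      by (simp add: 3 power_add algebra_simps)
    also have "\<dots> * qpoch q q (n + k') = qpoch q q (n + k)"
      unfolding N(2) by (simp add: qpoch_Suc)
    finally show ?thesis .
  qed
qed

text \<open>The summand \<open>(-1)\<^sup>m \<zeta>\<^sup>m q\<^bsup>m(m+1)/2\<^esup>\<close> of the triple product identity.\<close>

definition triple_term :: "complex \<Rightarrow> complex \<Rightarrow> int \<Rightarrow> complex" where
  "triple_term q \<zeta> m = (- \<zeta>) powi m * q powi (m * (m + 1) div 2)"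

text \<open>The exponent of \<open>q\<close> that appears when the \<open>q\<close>-binomial theorem is centred at \<open>j = N\<close>.\<close>

lemma choose_two_shift:
  "int (j choose 2) + int j - int N * int j + int (N choose 2) =
     (int j - int N) * (int j - int N + 1) div 2"
proof -
  have e: "2 * int (n choose 2) = int n * (int n - 1)" for n
  proof (cases n)
    case (Suc m)
    have "2 * (n choose 2) = n * (n - 1)"
      unfolding choose_two by (simp add: Suc)
    then have "int (2 * (n choose 2)) = int (n * (n - 1))" by (rule arg_cong)
    then show ?thesis by (simp add: Suc algebra_simps)
  qed simp
  have "2 * (int (j choose 2) + int j - int N * int j + int (N choose 2)) =
     int j * (int j - 1) + 2 * int j - 2 * int N * int j + int N * (int N - 1)"
    using e[of j] e[of N] by (simp add: algebra_simps)
  also have "\<dots> = (int j - int N) * (int j - int N + 1)" by (simp add: algebra_simps)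
  finally show ?thesis by presburger
qed

text \<open>The \<open>q\<close>-binomial theorem for \<open>2N\<close> factors at \<open>x = - \<zeta> q\<^bsup>1-N\<^esup>\<close>: the upper \<open>N\<close> factors are
  \<open>1 - \<zeta> q\<^bsup>i+1\<^esup>\<close>, and \<open>- \<zeta> q\<^bsup>-i\<^esup>\<close> is pulled out of the lower ones to leave
  \<open>1 - \<zeta>\<^bsup>-1\<^esup> q\<^sup>i\<close>.\<close>

lemma finite_triple_product:
  assumes "q \<noteq> 0" "\<zeta> \<noteq> 0"
  shows "qpoch (\<zeta> * q) q N * qpoch (inverse \<zeta>) q N =
     (\<Sum>j\<le>2 * N. triple_term q \<zeta> (int j - int N) * gauss_binomial q (2 * N) j)"
proof -
  define x where "x = - \<zeta> * q / q ^ N"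
  define C where "C = (- \<zeta>) powi int N * q powi (- int (N choose 2))"
  have "(\<Prod>k<2 * N. 1 + x * q ^ k) = (\<Prod>k<N. 1 + x * q ^ k) * (\<Prod>k<N. 1 + x * q ^ (N + k))"
  proof -
    have "(\<Prod>k<N + M. 1 + x * q ^ k) = (\<Prod>k<N. 1 + x * q ^ k) * (\<Prod>k<M. 1 + x * q ^ (N + k))" for M
      by (induction M) (simp_all add: mult_ac)
    then show ?thesis by (simp only: mult_2)
  qed
  also have "(\<Prod>k<N. 1 + x * q ^ (N + k)) = qpoch (\<zeta> * q) q N"
    unfolding qpoch_def x_def by (intro prod.cong) (use assms in \<open>auto simp: power_add field_simps\<close>)
  also have "(\<Prod>k<N. 1 + x * q ^ k) = (\<Prod>k<N. 1 + x * q ^ (N - Suc k))"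
    by (rule prod.nat_diff_reindex[symmetric])
  also have "\<dots> = (\<Prod>k<N. (- \<zeta> / q ^ k) * (1 - inverse \<zeta> * q ^ k))"
  proof (rule prod.cong)
    fix k assume "k \<in> {..<N}"
    then obtain i where "N = Suc (k + i)" by (metis add_Suc_right lessThan_iff less_imp_Suc_add)
    then show "1 + x * q ^ (N - Suc k) = (- \<zeta> / q ^ k) * (1 - inverse \<zeta> * q ^ k)"
      using assms by (simp add: x_def power_add field_simps)
  qed simp
  also have "\<dots> = C * qpoch (inverse \<zeta>) q N"
  proof -
    have "(\<Prod>k<N. - \<zeta> / q ^ k) = C"
      unfolding C_def using assms
      by (induction N) (auto simp: numeral_2_eq_2 power_int_add power_int_diff power_int_minus field_simps)
    then show ?thesis by (simp only: prod.distrib qpoch_def)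
  qed
  finally have "C * (qpoch (\<zeta> * q) q N * qpoch (inverse \<zeta>) q N) =
      (\<Sum>j\<le>2 * N. q ^ (j choose 2) * gauss_binomial q (2 * N) j * x ^ j)"
    by (simp add: q_binomial_theorem mult_ac)
  also have "\<dots> = (\<Sum>j\<le>2 * N. C * (triple_term q \<zeta> (int j - int N) * gauss_binomial q (2 * N) j))"
  proof (rule sum.cong)
    fix j
    have xj: "x ^ j = (- \<zeta>) ^ j * q ^ j / q ^ (N * j)"
      unfolding x_def by (simp only: power_divide power_mult_distrib power_mult)
    have "q ^ (j choose 2) * x ^ j = (- \<zeta>) powi int j * q powi (int (j choose 2) + int j - int N * int j)"
      unfolding xj using assms
      by (simp add: power_int_add power_int_diff flip: of_nat_mult)
    also have "\<dots> = C * triple_term q \<zeta> (int j - int N)"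
      unfolding C_def triple_term_def choose_two_shift[symmetric]
      using assms by (simp add: power_int_add power_int_diff power_int_minus field_simps)
    finally show "q ^ (j choose 2) * gauss_binomial q (2 * N) j * x ^ j =
        C * (triple_term q \<zeta> (int j - int N) * gauss_binomial q (2 * N) j)"
      by (simp add: mult_ac)
  qed simp
  finally show ?thesis
    using assms by (simp add: sum_distrib_left[symmetric] C_def)
qed


text \<open>Passage to the limit by Tannery's theorem: the centred Gaussian binomial coefficients are
  bounded uniformly in \<open>N\<close> and tend to \<open>1 / (q; q)\<^sub>\<infinity>\<close>.\<close>

lemma triple_product:
  assumes q: "q \<noteq> 0" "norm q < 1" and \<zeta>: "\<zeta> \<noteq> 0"
    and sm: "(\<lambda>m. norm (triple_term q \<zeta> m)) summable_on UNIV"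
  shows "(triple_term q \<zeta> has_sum
    qpoch_inf q q * (qpoch_inf (\<zeta> * q) q * qpoch_inf (inverse \<zeta>) q)) UNIV"
proof -
  define E where "E = qpoch q q"
  define E' where "E' = qpoch_inf q q"
  have E_lim: "E \<longlonglongrightarrow> E'" and E'0: "E' \<noteq> 0" and E0: "E n \<noteq> 0" for n
    using q by (auto simp: E_def E'_def qpoch_inf_diag_nonzero qpoch_diag_nonzero intro: qpoch_LIMSEQ)
  define g where "g N m = (if \<bar>m\<bar> \<le> int N then gauss_binomial q (2 * N) (nat (int N + m)) else 0)" for N m
  have g_eq: "g N m = E (2 * N) * inverse (E (nat (int N + m))) * inverse (E (nat (int N - m)))"
    if "\<bar>m\<bar> \<le> int N" for N m
  proof -
    have "nat (int N - m) + nat (int N + m) = 2 * N" using that by linarith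
    then show ?thesis
      using gauss_binomial_mult_qpoch[of q "nat (int N - m)" "nat (int N + m)"] E0 that
      by (simp add: g_def E_def[symmetric] field_simps)
  qed
  have g_lim: "(\<lambda>N. g N m) \<longlonglongrightarrow> inverse E'" for m
  proof -
    have l: "(\<lambda>N. E (nat (int N + i))) \<longlonglongrightarrow> E'" for i
    proof (rule filterlim_compose[OF E_lim])
      show "filterlim (\<lambda>N. nat (int N + i)) sequentially sequentially"
        unfolding filterlim_at_top
        by (intro allI, rule_tac c = "Z + nat \<bar>i\<bar>" in eventually_sequentiallyI) linarith
    qed
    have "(\<lambda>N. E (2 * N)) \<longlonglongrightarrow> E'"
      by (rule filterlim_compose[OF E_lim]) (intro mult_nat_left_at_top, simp)
    then have "(\<lambda>N. E (2 * N) * inverse (E (nat (int N + m))) * inverse (E (nat (int N - m))))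
        \<longlonglongrightarrow> E' * inverse E' * inverse E'"
      using l[of m] l[of "- m"] E'0 by (intro tendsto_intros) auto
    moreover have "\<forall>\<^sub>F N in sequentially.
        E (2 * N) * inverse (E (nat (int N + m))) * inverse (E (nat (int N - m))) = g N m"
      by (rule eventually_sequentiallyI[of "nat \<bar>m\<bar>"]) (simp add: g_eq)
    ultimately show ?thesis using E'0 by (simp add: filterlim_cong[OF refl refl])
  qed
  obtain B1 where B1: "\<And>n. norm (E n) \<le> B1" "B1 > 0"
    using convergent_imp_Bseq[OF convergentI[OF E_lim]] unfolding Bseq_def by blast
  obtain B2 where B2: "\<And>n. norm (inverse (E n)) \<le> B2" "B2 > 0"
    using convergent_imp_Bseq[OF convergentI[OF tendsto_inverse[OF E_lim E'0]]] unfolding Bseq_def by blast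
  have g_bound: "norm (g N m) \<le> B1 * B2 * B2" for N m
  proof (cases "\<bar>m\<bar> \<le> int N")
    case True
    show ?thesis
      unfolding g_eq[OF True] norm_mult using B1 B2 by (intro mult_mono) auto
  qed (use B1 B2 in \<open>auto simp: g_def\<close>)
  define f where "f = triple_term q \<zeta>"
  have fs: "summable (\<lambda>k. norm (f (int_decode k)))"
    using sm summable_on_reindex_bij_betw[OF bij_int_decode, of "\<lambda>m. norm (f m)"]
    by (intro summable_on_imp_summable) (simp add: f_def)
  have l1: "(\<lambda>N. \<Sum>k. f (int_decode k) * g N (int_decode k)) \<longlonglongrightarrow> (\<Sum>k. f (int_decode k) * inverse E')"
  proof (rule tannerys_theorem[THEN conjunct2, THEN conjunct2])
    show "(\<lambda>N. f (int_decode k) * g N (int_decode k)) \<longlonglongrightarrow> f (int_decode k) * inverse E'" for k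
      by (intro tendsto_intros g_lim)
    show "\<forall>\<^sub>F (k, N) in sequentially \<times>\<^sub>F sequentially.
        norm (f (int_decode k) * g N (int_decode k)) \<le> norm (f (int_decode k)) * (B1 * B2 * B2)"
      by (auto simp: norm_mult intro!: always_eventually mult_left_mono g_bound)
    show "summable (\<lambda>k. norm (f (int_decode k)) * (B1 * B2 * B2))"
      by (intro summable_mult2 fs)
  qed simp
  have l2: "(\<Sum>k. f (int_decode k) * g N (int_decode k)) =
      qpoch (\<zeta> * q) q N * qpoch (inverse \<zeta>) q N" for N
  proof -
    have "((\<lambda>m. f m * g N m) has_sum (\<Sum>m\<in>{- int N..int N}. f m * g N m)) UNIV"
      by (rule has_sum_finite_neutralI[where B = "{- int N..int N}"]) (auto simp: g_def)
    then have "(\<lambda>k. f (int_decode k) * g N (int_decode k)) sums (\<Sum>m\<in>{- int N..int N}. f m * g N m)"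
      using has_sum_int_decode_iff[of "\<lambda>m. f m * g N m"] by (intro has_sum_imp_sums) auto
    moreover have "(\<Sum>m\<in>{- int N..int N}. f m * g N m) =
        (\<Sum>j\<le>2 * N. f (int j - int N) * gauss_binomial q (2 * N) j)"
      by (rule sum.reindex_bij_witness[of _ "\<lambda>j. int j - int N" "\<lambda>m. nat (int N + m)"])
        (auto simp: g_def)
    ultimately show ?thesis
      using finite_triple_product[OF q(1) \<zeta>, of N] by (simp add: sums_iff f_def)
  qed
  have l3: "(\<lambda>N. qpoch (\<zeta> * q) q N * qpoch (inverse \<zeta>) q N) \<longlonglongrightarrow>
      qpoch_inf (\<zeta> * q) q * qpoch_inf (inverse \<zeta>) q"
    by (intro tendsto_mult qpoch_LIMSEQ q)
  have e0: "(\<Sum>k. f (int_decode k) * inverse E') = qpoch_inf (\<zeta> * q) q * qpoch_inf (inverse \<zeta>) q"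
    by (rule LIMSEQ_unique[OF l1[unfolded l2] l3])
  have hs: "(f has_sum infsum f UNIV) UNIV"
    unfolding f_def by (rule has_sum_infsum[OF Infinite_Sum.abs_summable_summable[OF sm]])
  then have "(\<lambda>k. f (int_decode k)) sums infsum f UNIV"
    using has_sum_int_decode_iff[of f] by (intro has_sum_imp_sums) auto
  then have "(\<lambda>k. f (int_decode k) * inverse E') sums (infsum f UNIV * inverse E')"
    by (rule sums_mult2)
  then have "infsum f UNIV * inverse E' = qpoch_inf (\<zeta> * q) q * qpoch_inf (inverse \<zeta>) q"
    using e0 sums_unique by metis
  then have "infsum f UNIV = qpoch_inf (\<zeta> * q) q * qpoch_inf (inverse \<zeta>) q * E'"
    using E'0 unfolding divide_inverse[symmetric] by (simp only: divide_eq_eq if_False not_False_eq_True if_True)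
  then show ?thesis using hs
    by (simp add: f_def E'_def mult_ac)
qed

lemma norm_nome_less_1: "Im \<tau> > 0 \<Longrightarrow> norm (exp (2 * pi * \<i> * \<tau>)) < 1"
  by (simp add: norm_exp_eq_Re)

lemma theta_term_odd:
  "theta_term 0 \<tau> z (2 * m + 1) = exp (pi * \<i> * \<tau> / 4) * exp (pi * \<i> * z) *
     triple_term (exp (2 * pi * \<i> * \<tau>)) (exp (2 * pi * \<i> * z)) m"
proof -
  have c: "of_int (chi4 (2 * m + 1)) = ((- 1) powi m :: complex)"
    by (simp add: chi4_odd power_int_minus_left)
  have t: "of_int (m * (m + 1) div 2) = (of_int m * (of_int m + 1) / 2 :: complex)"
  proof -
    have "2 * (m * (m + 1) div 2) = m * (m + 1)" by simp
    then have "of_int (2 * (m * (m + 1) div 2)) = (of_int (m * (m + 1)) :: complex)" by (rule arg_cong)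
    then have "2 * of_int (m * (m + 1) div 2) = (of_int m * (of_int m + 1) :: complex)"
      unfolding of_int_mult of_int_add of_int_1 of_int_numeral .
    then show ?thesis by (simp add: field_simps)
  qed
  have "exp (2 * pi * \<i> * (of_int (2 * m + 1) ^ 2 / 8 * \<tau> + of_int (2 * m + 1) / 2 * z)) =
    exp (pi * \<i> * \<tau> / 4) * exp (pi * \<i> * z) *
    (exp (of_int m * (2 * pi * \<i> * z)) * exp (of_int (m * (m + 1) div 2) * (2 * pi * \<i> * \<tau>)))"
    unfolding exp_add[symmetric] t
    by (rule arg_cong[where f = exp]) (simp add: field_simps power2_eq_square)
  moreover have "(- exp (2 * pi * \<i> * z)) powi m = (- 1) powi m * exp (2 * pi * \<i> * z) powi m"
    by (metis mult_minus1 power_int_mult_distrib)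
  ultimately show ?thesis
    unfolding theta_term_def triple_term_def by (simp add: c exp_power_int)
qed

text \<open>Only odd \<open>n = 2m + 1\<close> contribute to \<open>\<vartheta>\<close>, so it is a triple product with
  \<open>\<zeta> = e\<^bsup>2\<pi>iz\<^esup>\<close>.\<close>

theorem theta_product:
  assumes "Im \<tau> > 0"
  defines "q \<equiv> exp (2 * pi * \<i> * \<tau>)"
  shows "theta \<tau> z = exp (pi * \<i> * \<tau> / 4) * exp (pi * \<i> * z) * (qpoch_inf q q *
    (qpoch_inf (exp (2 * pi * \<i> * z) * q) q * qpoch_inf (inverse (exp (2 * pi * \<i> * z))) q))"
proof -
  define \<zeta> where "\<zeta> = exp (2 * pi * \<i> * z)"
  define C where "C = exp (pi * \<i> * \<tau> / 4) * exp (pi * \<i> * z)"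
  have inj: "inj (\<lambda>m::int. 2 * m + 1)" by (auto simp: inj_on_def)
  have C0: "C \<noteq> 0" by (simp add: C_def)
  have tt: "theta_term 0 \<tau> z (2 * m + 1) = C * triple_term q \<zeta> m" for m
    by (simp add: theta_term_odd C_def q_def \<zeta>_def)
  have "(\<lambda>n. norm (theta_term 0 \<tau> z n)) summable_on range (\<lambda>m. 2 * m + 1)"
    using theta_term_abs_summable[OF assms(1)] by (rule summable_on_subset) auto
  then have "(\<lambda>m. norm (C * triple_term q \<zeta> m)) summable_on UNIV"
    by (subst (asm) summable_on_reindex[OF inj]) (simp add: o_def tt)
  then have "(\<lambda>m. norm C * norm (triple_term q \<zeta> m)) summable_on UNIV"
    by (simp add: norm_mult)
  then have "(\<lambda>m. norm (triple_term q \<zeta> m)) summable_on UNIV"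
    by (subst (asm) summable_on_cmult_right') (use C0 in auto)
  then have "(triple_term q \<zeta> has_sum
      qpoch_inf q q * (qpoch_inf (\<zeta> * q) q * qpoch_inf (inverse \<zeta>) q)) UNIV"
    by (intro triple_product) (use norm_nome_less_1[OF assms(1)] in \<open>auto simp: q_def \<zeta>_def\<close>)
  then have "((\<lambda>m. C * triple_term q \<zeta> m) has_sum
      C * (qpoch_inf q q * (qpoch_inf (\<zeta> * q) q * qpoch_inf (inverse \<zeta>) q))) UNIV"
    by (rule has_sum_cmult_right)
  then have "(theta_term 0 \<tau> z has_sum
      C * (qpoch_inf q q * (qpoch_inf (\<zeta> * q) q * qpoch_inf (inverse \<zeta>) q))) (range (\<lambda>m. 2 * m + 1))"
    by (subst has_sum_reindex[OF inj]) (simp add: o_def tt)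
  then have "(theta_term 0 \<tau> z has_sum
      C * (qpoch_inf q q * (qpoch_inf (\<zeta> * q) q * qpoch_inf (inverse \<zeta>) q))) UNIV"
  proof (rule has_sum_cong_neutral[THEN iffD1, rotated -1])
    fix n :: int assume "n \<in> UNIV - range (\<lambda>m. 2 * m + 1)"
    then have "even n" by (metis Diff_iff oddE rangeI)
    then show "theta_term 0 \<tau> z n = 0" by (simp add: theta_term_def chi4_even)
  qed auto
  with theta_term_has_sum[OF assms(1)] show ?thesis
    by (auto dest: has_sum_unique simp: theta_eq_moment C_def \<zeta>_def)
qed

section \<open>Zeros of theta and the derivative at the origin\<close>

lemma dedekind_eta_eq:
  "dedekind_eta \<tau> = exp (pi * \<i> * \<tau> / 12) * qpoch_inf (exp (2 * pi * \<i> * \<tau>)) (exp (2 * pi * \<i> * \<tau>))"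
proof -
  have "exp (2 * pi * \<i> * of_nat (Suc k) * \<tau>) = exp (2 * pi * \<i> * \<tau>) * exp (2 * pi * \<i> * \<tau>) ^ k" for k
    by (simp add: exp_of_nat_mult[symmetric] exp_add[symmetric] algebra_simps)
  then show ?thesis by (simp only: dedekind_eta_def qpoch_inf_def)
qed

lemma dedekind_eta_nonzero: "Im \<tau> > 0 \<Longrightarrow> dedekind_eta \<tau> \<noteq> 0"
  by (simp add: dedekind_eta_eq qpoch_inf_diag_nonzero norm_nome_less_1)

lemma dedekind_eta_holomorphic: "dedekind_eta holomorphic_on {\<tau>. Im \<tau> > 0}"
proof -
  have "(\<lambda>\<tau>. exp (pi * \<i> * \<tau> / 12) * ((\<lambda>q. qpoch_inf q q) \<circ> (\<lambda>\<tau>. exp (2 * pi * \<i> * \<tau>))) \<tau>)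
      holomorphic_on {\<tau>. Im \<tau> > 0}"
    by (intro holomorphic_on_mult holomorphic_on_compose_gen[OF _ qpoch_inf_diag_holomorphic])
      (auto intro!: holomorphic_intros norm_nome_less_1)
  then show ?thesis by (simp add: dedekind_eta_eq[abs_def] o_def)
qed

lemma exp_2pi_eq_1D: "exp (2 * pi * \<i> * w) = 1 \<Longrightarrow> \<exists>n::int. w = of_int n"
proof -
  assume "exp (2 * pi * \<i> * w) = 1"
  then obtain n :: int where "Im (2 * pi * \<i> * w) = of_int (2 * n) * pi" "Re (2 * pi * \<i> * w) = 0"
    by (auto simp: exp_eq_1)
  then have "w = of_int n" by (simp add: complex_eq_iff)
  then show ?thesis ..
qed

lemma theta_zeroD:
  assumes "Im \<tau> > 0" "theta \<tau> z = 0"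
  shows "\<exists>m n :: int. z = of_int m * \<tau> + of_int n"
proof -
  define q where "q = exp (2 * pi * \<i> * \<tau>)"
  have q: "norm q < 1" using norm_nome_less_1[OF assms(1)] by (simp add: q_def)
  have qk: "q ^ k = exp (2 * pi * \<i> * (of_nat k * \<tau>))" for k
    by (simp add: q_def exp_of_nat_mult[symmetric] algebra_simps)
  have "qpoch_inf (exp (2 * pi * \<i> * z) * q) q = 0 \<or> qpoch_inf (inverse (exp (2 * pi * \<i> * z))) q = 0"
    using theta_product[OF assms(1), of z] assms(2) qpoch_inf_diag_nonzero[OF q] by (simp add: q_def)
  then consider k where "exp (2 * pi * \<i> * z) * q * q ^ k = 1" | k where "inverse (exp (2 * pi * \<i> * z)) * q ^ k = 1"
    using qpoch_inf_nonzero[OF q] by metis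
  then show ?thesis
  proof cases
    case (1 k)
    have "exp (2 * pi * \<i> * (z + of_nat (Suc k) * \<tau>)) = 1"
    proof -
      have "exp (2 * pi * \<i> * (z + of_nat (Suc k) * \<tau>)) = exp (2 * pi * \<i> * z) * q ^ Suc k"
        unfolding qk exp_add[symmetric] by (simp only: algebra_simps)
      then show ?thesis using 1 by (simp add: mult_ac)
    qed
    then obtain n :: int where "z + of_nat (Suc k) * \<tau> = of_int n" using exp_2pi_eq_1D by blast
    then have "z = of_int (- int (Suc k)) * \<tau> + of_int n" by (simp add: algebra_simps)
    then show ?thesis by blast
  next
    case (2 k)
    have "exp (2 * pi * \<i> * (of_nat k * \<tau> - z)) = 1"
      using 2 unfolding qk by (simp add: exp_minus[symmetric] exp_add[symmetric] algebra_simps)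
    then obtain n :: int where "of_nat k * \<tau> - z = of_int n" using exp_2pi_eq_1D by blast
    then have "z = of_int (int k) * \<tau> + of_int (- n)" by (simp add: algebra_simps)
    then show ?thesis by blast
  qed
qed

lemma theta_0: "theta \<tau> 0 = 0"
  using theta_uminus[of \<tau> 0] by simp

text \<open>Jacobi's derivative formula \<open>\<vartheta>'(0) = 2\<pi>i \<eta>\<^sup>3\<close>.\<close>

theorem theta_moment_1_eq_eta_cubed:
  assumes "Im \<tau> > 0"
  shows "theta_moment 1 \<tau> 0 = 2 * dedekind_eta \<tau> ^ 3"
proof -
  define q where "q = exp (2 * pi * \<i> * \<tau>)"
  have q: "norm q < 1" using norm_nome_less_1[OF assms] by (simp add: q_def)
  define G where "G z = exp (pi * \<i> * \<tau> / 4) * exp (pi * \<i> * z) * (qpoch_inf q q *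
    (qpoch_inf (exp (2 * pi * \<i> * z) * q) q * qpoch_inf (exp (- (2 * pi * \<i> * z)) * q) q))" for z
  have eq: "theta \<tau> z = (1 - exp (- (2 * pi * \<i> * z))) * G z" for z
    using theta_product[OF assms, of z] qpoch_inf_split_head[OF q, of "exp (- (2 * pi * \<i> * z))"]
    by (simp add: G_def q_def exp_minus[symmetric] mult_ac)
  have P: "(\<lambda>z. qpoch_inf (exp (c * z) * q) q) holomorphic_on UNIV" for c
  proof -
    have "((\<lambda>y. qpoch_inf y q) \<circ> (\<lambda>z. exp (c * z) * q)) holomorphic_on UNIV"
      by (rule holomorphic_on_compose_gen[OF _ qpoch_inf_holomorphic[OF q]]) (auto intro!: holomorphic_intros)
    then show ?thesis by (simp add: o_def)
  qed
  have "G holomorphic_on UNIV"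
    unfolding G_def using P[of "2 * pi * \<i>"] P[of "- (2 * pi * \<i>)"]
    by (intro holomorphic_intros) auto
  then have dG: "(G has_field_derivative deriv G 0) (at 0)"
    by (rule holomorphic_derivI) auto
  have "((\<lambda>z. (1 - exp (- (2 * pi * \<i> * z))) * G z) has_field_derivative 2 * pi * \<i> * G 0) (at 0)"
    by (rule derivative_eq_intros dG refl | simp)+
  then have "(theta \<tau> has_field_derivative 2 * pi * \<i> * G 0) (at 0)"
    by (simp add: eq[abs_def])
  moreover have "(theta \<tau> has_field_derivative pi * \<i> * theta_moment 1 \<tau> 0) (at 0)"
    using theta_moment_has_field_derivative_z[OF assms, of 0 0] by (simp add: theta_eq_moment)
  ultimately have "pi * \<i> * theta_moment 1 \<tau> 0 = 2 * pi * \<i> * G 0"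
    by (rule DERIV_unique[symmetric])
  then have "theta_moment 1 \<tau> 0 = 2 * G 0" by simp
  also have "G 0 = dedekind_eta \<tau> ^ 3"
  proof -
    have "exp (pi * \<i> * \<tau> / 4) = exp (pi * \<i> * \<tau> / 12) ^ 3"
      unfolding power3_eq_cube exp_add[symmetric] by (rule arg_cong[where f = exp]) (simp add: field_simps)
    then show ?thesis
      by (simp add: G_def dedekind_eta_eq q_def power_mult_distrib power3_eq_cube)
  qed
  finally show ?thesis .
qed

section \<open>Modular transformation of theta and eta\<close>

text \<open>An entire function that vanishes at all zeros of \<open>g\<close> is divisible by \<open>g\<close> if these zeros are
  simple.\<close>

lemma entire_quotient:
  fixes f g :: "complex \<Rightarrow> complex"
  assumes f: "f holomorphic_on UNIV" and g: "g holomorphic_on UNIV"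
    and z: "\<And>z. g z = 0 \<Longrightarrow> f z = 0 \<and> deriv g z \<noteq> 0"
  obtains h where "h holomorphic_on UNIV" "\<And>z. f z = h z * g z"
proof -
  define h where "h z = (if g z = 0 then deriv f z / deriv g z else f z / g z)" for z
  have "h analytic_on {a}" for a
  proof (cases "g a = 0")
    case False
    have "open {z. g z \<noteq> 0}"
      by (intro open_Collect_neq holomorphic_on_imp_continuous_on[OF g] continuous_on_const)
    moreover have "h holomorphic_on {z. g z \<noteq> 0}"
      by (rule holomorphic_transform[of "\<lambda>z. f z / g z"])
        (auto simp: h_def intro!: holomorphic_intros holomorphic_on_subset[OF f] holomorphic_on_subset[OF g])
    ultimately show ?thesis using False analytic_at by blast
  next
    case True
    define f1 where "f1 z = (if z = a then deriv f a else (f z - f a) / (z - a))" for z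
    define g1 where "g1 z = (if z = a then deriv g a else (g z - g a) / (z - a))" for z
    have f1: "f1 holomorphic_on UNIV" and g1: "g1 holomorphic_on UNIV"
      unfolding f1_def g1_def by (auto intro!: pole_lemma_open f g)
    have op: "open {z. g1 z \<noteq> 0}"
      by (intro open_Collect_neq holomorphic_on_imp_continuous_on[OF g1] continuous_on_const)
    have hq: "f1 z / g1 z = h z" if "g1 z \<noteq> 0" for z
      using that z[OF True] True by (auto simp: h_def f1_def g1_def)
    have "(\<lambda>z. f1 z / g1 z) holomorphic_on {z. g1 z \<noteq> 0}"
      by (intro holomorphic_on_divide holomorphic_on_subset[OF f1] holomorphic_on_subset[OF g1]) auto
    then have "h holomorphic_on {z. g1 z \<noteq> 0}"
      by (rule holomorphic_transform) (simp add: hq)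
    moreover have "g1 a \<noteq> 0" using z[OF True] by (simp add: g1_def)
    ultimately show ?thesis using op analytic_at by blast
  qed
  then have "h holomorphic_on UNIV"
    by (meson analytic_imp_holomorphic analytic_on_analytic_at)
  moreover have "f z = h z * g z" for z
    using z by (auto simp: h_def)
  ultimately show ?thesis using that by blast
qed

lemma theta_holomorphic: "Im \<tau> > 0 \<Longrightarrow> theta \<tau> holomorphic_on UNIV"
  unfolding theta_eq_moment
  using theta_moment_has_field_derivative_z holomorphic_on_open by blast

text \<open>The zeros of \<open>\<vartheta>(\<tau>, \<cdot>)\<close> are simple: at \<open>0\<close> because \<open>\<eta>(\<tau>) \<noteq> 0\<close>, and then at every lattice
  point by quasi-periodicity.\<close>

lemma theta_deriv_lattice:
  assumes "Im \<tau> > 0"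
  shows "deriv (theta \<tau>) (of_int m * \<tau> + of_int n) \<noteq> 0"
proof -
  define w where "w = of_int m * \<tau> + of_int n"
  define U where "U z = (-1) powi (m + n) * exp (- pi * \<i> * (of_int m ^ 2 * \<tau> + 2 * of_int m * z))" for z
  have t: "(theta \<tau> has_field_derivative pi * \<i> * theta_moment 1 \<tau> z) (at z)" for z
    using theta_moment_has_field_derivative_z[OF assms, of 0 z] by (simp add: theta_eq_moment)
  have t0: "(theta \<tau> has_field_derivative 2 * pi * \<i> * dedekind_eta \<tau> ^ 3) (at 0)"
    using t[of 0] theta_moment_1_eq_eta_cubed[OF assms] by (simp add: mult_ac)
  have "((\<lambda>z. theta \<tau> (z + w)) has_field_derivative pi * \<i> * theta_moment 1 \<tau> w) (at 0)"
    using DERIV_shift[of "theta \<tau>" _ 0 w] t[of w] by simp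
  moreover have "theta \<tau> (z + w) = U z * theta \<tau> z" for z
    using theta_add_lattice[of \<tau> z m n] by (simp add: w_def U_def add.assoc)
  moreover have "((\<lambda>z. U z * theta \<tau> z) has_field_derivative U 0 * (2 * pi * \<i> * dedekind_eta \<tau> ^ 3)) (at 0)"
  proof -
    have "(U has_field_derivative deriv U 0) (at 0)"
      unfolding U_def by (rule holomorphic_derivI[where S = UNIV]) (auto intro!: holomorphic_intros)
    from DERIV_mult[OF this t0] show ?thesis by (simp add: theta_0 mult.commute)
  qed
  ultimately have "pi * \<i> * theta_moment 1 \<tau> w = U 0 * (2 * pi * \<i> * dedekind_eta \<tau> ^ 3)"
    by (simp add: DERIV_unique)
  moreover have "deriv (theta \<tau>) w = pi * \<i> * theta_moment 1 \<tau> w"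
    by (rule DERIV_imp_deriv[OF t])
  ultimately show ?thesis
    using dedekind_eta_nonzero[OF assms] by (simp add: w_def[symmetric] U_def)
qed

lemma lattice_reduction:
  assumes "Im \<tau> > 0"
  obtains m n :: int and s t :: real where "0 \<le> s" "s \<le> 1" "0 \<le> t" "t \<le> 1"
    "z = of_real s + of_real t * \<tau> + of_int m * \<tau> + of_int n"
proof -
  define T where "T = Im z / Im \<tau>"
  define S where "S = Re z - T * Re \<tau>"
  have z: "z = of_real S + of_real T * \<tau>"
    using assms by (simp add: complex_eq_iff S_def T_def)
  have "z = of_real (frac S) + of_real (frac T) * \<tau> + of_int \<lfloor>T\<rfloor> * \<tau> + of_int \<lfloor>S\<rfloor>"
    unfolding z frac_def by (simp add: algebra_simps)
  then show ?thesis
    by (intro that[of "frac S" "frac T"]) (auto intro: less_imp_le frac_lt_1)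
qed

text \<open>Uniqueness of \<open>\<vartheta>\<close>: the quotient by \<open>\<vartheta>\<close> is entire with doubly periodic absolute value,
  hence bounded, hence constant.\<close>

lemma entire_multiple_of_theta:
  assumes \<tau>: "Im \<tau> > 0" and F: "F holomorphic_on UNIV" and F0: "F 0 = 0"
    and quasi: "\<And>z m n. norm (F (z + of_int m * \<tau> + of_int n)) =
      norm (exp (- pi * \<i> * (of_int m ^ 2 * \<tau> + 2 * of_int m * z))) * norm (F z)"
  shows "\<exists>C. \<forall>z. F z = C * theta \<tau> z"
proof -
  have "F z = 0 \<and> deriv (theta \<tau>) z \<noteq> 0" if z0: "theta \<tau> z = 0" for z
  proof -
    obtain m n :: int where z: "z = of_int m * \<tau> + of_int n" using theta_zeroD[OF \<tau> z0] by blast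
    then show ?thesis using quasi[of 0 m n] F0 theta_deriv_lattice[OF \<tau>] by simp
  qed
  from entire_quotient[OF F theta_holomorphic[OF \<tau>] this]
  obtain h where h: "h holomorphic_on UNIV" "\<And>z. F z = h z * theta \<tau> z" by blast
  have per: "norm (h (z + of_int m * \<tau> + of_int n)) = norm (h z)" if "theta \<tau> z \<noteq> 0" for z and m n :: int
  proof -
    have "norm (h (z + of_int m * \<tau> + of_int n)) * norm (theta \<tau> (z + of_int m * \<tau> + of_int n)) =
      norm (exp (- pi * \<i> * (of_int m ^ 2 * \<tau> + 2 * of_int m * z))) * (norm (h z) * norm (theta \<tau> z))"
      using quasi[of z m n] by (simp only: h(2) norm_mult)
    moreover have "norm (theta \<tau> (z + of_int m * \<tau> + of_int n)) =
      norm (exp (- pi * \<i> * (of_int m ^ 2 * \<tau> + 2 * of_int m * z))) * norm (theta \<tau> z)"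
      unfolding theta_add_lattice norm_mult by (simp add: norm_power_int)
    ultimately show ?thesis using that by simp
  qed
  \<comment> \<open>a closed period parallelogram, on which the quotient is bounded\<close>
  define K where "K = (\<lambda>(s, t). of_real s + of_real t * \<tau>) ` ({0..1} \<times> {0..1::real})"
  have "compact K"
    unfolding K_def case_prod_beta
    by (intro compact_continuous_image continuous_intros compact_Times compact_Icc)
  moreover have "continuous_on K h"
    using holomorphic_on_imp_continuous_on[OF h(1)] continuous_on_subset by blast
  ultimately have "bounded (h ` K)"
    using compact_continuous_image compact_imp_bounded by blast
  then obtain B where "\<forall>w\<in>h ` K. norm w \<le> B"
    unfolding bounded_iff ..
  then have B: "norm (h z) \<le> B" if "z \<in> K" for z
    using that by simp
  have b: "norm (h z) \<le> B" if "theta \<tau> z \<noteq> 0" for z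
  proof -
    obtain m n :: int and s t :: real where z: "0 \<le> s" "s \<le> 1" "0 \<le> t" "t \<le> 1"
      "z = of_real s + of_real t * \<tau> + of_int m * \<tau> + of_int n"
      by (rule lattice_reduction[OF \<tau>])
    define k where "k = of_real s + of_real t * \<tau>"
    have "k \<in> K" unfolding K_def k_def using z by force
    moreover have "theta \<tau> k \<noteq> 0"
      using that theta_add_lattice[of \<tau> k m n] by (auto simp: z(5) k_def)
    ultimately show ?thesis
      using B per[of k m n] by (simp add: z(5) k_def)
  qed
  \<comment> \<open>the bound extends to the zeros of theta by continuity, as these are isolated\<close>
  have "norm (h z) \<le> B" for z
  proof (rule ccontr)
    assume "\<not> norm (h z) \<le> B"
    then have "theta \<tau> z = 0" and gt: "norm (h z) > B" using b by auto
    then obtain m n :: int where "z = of_int m * \<tau> + of_int n" using theta_zeroD[OF \<tau>] by blast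
    then have d: "deriv (theta \<tau>) z \<noteq> 0" using theta_deriv_lattice[OF \<tau>] by simp
    have "(theta \<tau> has_field_derivative deriv (theta \<tau>) z) (at z)"
      using theta_holomorphic[OF \<tau>] by (intro holomorphic_derivI[where S = UNIV]) auto
    then have "((\<lambda>w. (theta \<tau> w - theta \<tau> z) / (w - z)) \<longlongrightarrow> deriv (theta \<tau>) z) (at z)"
      by (simp add: has_field_derivative_iff)
    then have "\<forall>\<^sub>F w in at z. (theta \<tau> w - theta \<tau> z) / (w - z) \<noteq> 0"
      using d by (rule tendsto_imp_eventually_ne)
    moreover have "\<forall>\<^sub>F w in at z. norm (h w) > B"
    proof (rule order_tendstoD(1)[OF _ gt])
      have "isCont h z"
        using holomorphic_on_imp_continuous_on[OF h(1)] continuous_on_eq_continuous_at by blast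
      then show "((\<lambda>w. norm (h w)) \<longlongrightarrow> norm (h z)) (at z)"
        by (intro tendsto_norm) (simp add: isCont_def)
    qed
    ultimately have "\<forall>\<^sub>F w in at z. False"
    proof eventually_elim
      case (elim w)
      then show ?case using b[of w] \<open>theta \<tau> z = 0\<close> by auto
    qed
    then show False by simp
  qed
  then have "bounded (range h)" by (auto simp: bounded_iff)
  with h(1) have "h constant_on UNIV" by (rule Liouville_theorem)
  then obtain C where "\<And>z. h z = C" unfolding constant_on_def by auto
  then show ?thesis using h(2) by auto
qed

context
  fixes a b c d :: int
  assumes det: "a * d - b * c = 1"
begin

text \<open>The automorphy factor \<open>c\<tau> + d\<close> of the matrix with rows \<open>(a, b)\<close>, \<open>(c, d)\<close>, and its
  action on the upper half plane.\<close>

definition cocycle :: "complex \<Rightarrow> complex" where "cocycle \<tau> = of_int c * \<tau> + of_int d"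
definition moebius :: "complex \<Rightarrow> complex" where "moebius \<tau> = (of_int a * \<tau> + of_int b) / cocycle \<tau>"

lemma cocycle_nonzero: "Im \<tau> > 0 \<Longrightarrow> cocycle \<tau> \<noteq> 0"
proof
  assume "Im \<tau> > 0" "cocycle \<tau> = 0"
  then have "Im (cocycle \<tau>) = 0" "Re (cocycle \<tau>) = 0" by auto
  then have "c = 0 \<and> d = 0" unfolding cocycle_def using \<open>Im \<tau> > 0\<close> by auto
  then show False using det by simp
qed

lemma Im_moebius: "Im \<tau> > 0 \<Longrightarrow> Im (moebius \<tau>) > 0"
proof -
  assume t: "Im \<tau> > 0"
  have "Im ((of_int a * \<tau> + of_int b) * cnj (cocycle \<tau>)) = of_int (a * d - b * c) * Im \<tau>"
    by (simp add: cocycle_def algebra_simps)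
  then show ?thesis unfolding moebius_def Im_complex_div_gt_0 using t det by simp
qed

lemma cdet: "of_int a * of_int d = (1 + of_int b * of_int c :: complex)"
proof -
  have "of_int (a * d) = (of_int (1 + b * c) :: complex)" using det by (simp add: algebra_simps)
  then show ?thesis by simp
qed

text \<open>With \<open>\<kappa> = heat_exponent \<tau>\<close>, the function \<open>exp(\<kappa> z\<^sup>2) \<vartheta>(A\<tau>, z / (c\<tau> + d))\<close> of \<open>z\<close> has the
  quasi-periods of \<open>\<vartheta>(\<tau>, z)\<close> up to factors of absolute value one.\<close>

definition heat_exponent :: "complex \<Rightarrow> complex" where "heat_exponent \<tau> = - pi * \<i> * of_int c / cocycle \<tau>"

text \<open>The matrix permutes the lattice: \<open>(m\<tau> + n) / (c\<tau> + d) = m' A\<tau> + n'\<close> with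
  \<open>m' = dm - cn\<close> and \<open>n' = an - bm\<close>. The exponentials agree up to \<open>exp(- \<pi>i k)\<close> with an integer
  \<open>k\<close>, which has absolute value one.\<close>

lemma slash_quasi_periodic:
  assumes \<tau>: "Im \<tau> > 0"
  shows "norm (exp (heat_exponent \<tau> * (z + of_int m * \<tau> + of_int n)\<^sup>2) * theta (moebius \<tau>) ((z + of_int m * \<tau> + of_int n) / cocycle \<tau>)) =
     norm (exp (- pi * \<i> * (of_int m ^ 2 * \<tau> + 2 * of_int m * z))) *
     norm (exp (heat_exponent \<tau> * z\<^sup>2) * theta (moebius \<tau>) (z / cocycle \<tau>))"
proof -
  define m' where "m' = d * m - c * n"
  define n' where "n' = a * n - b * m"
  define k where "k = b * d * m\<^sup>2 - 2 * b * c * m * n + a * c * n\<^sup>2"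
  define Jt where "Jt = cocycle \<tau>"
  have J0: "Jt \<noteq> 0" using cocycle_nonzero[OF \<tau>] by (simp add: Jt_def)
  have MJ: "moebius \<tau> * Jt = of_int a * \<tau> + of_int b" using J0 by (simp add: moebius_def Jt_def)
  have Jt: "Jt = of_int c * \<tau> + of_int d" by (simp add: Jt_def cocycle_def)
  have arg: "(z + of_int m * \<tau> + of_int n) / Jt = z / Jt + of_int m' * moebius \<tau> + of_int n'"
  proof -
    have "(of_int m' * moebius \<tau> + of_int n') * Jt = of_int m' * (moebius \<tau> * Jt) + of_int n' * Jt"
      by (simp add: algebra_simps)
    also have "\<dots> = (of_int a * of_int d - of_int b * of_int c) * (of_int m * \<tau> + of_int n)"
      unfolding MJ unfolding Jt m'_def n'_def of_int_mult of_int_diff by algebra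
    also have "\<dots> = of_int m * \<tau> + of_int n" by (simp add: cdet)
    finally show ?thesis using J0 by (simp add: field_simps)
  qed
  have e: "heat_exponent \<tau> * (z + of_int m * \<tau> + of_int n)\<^sup>2 + - pi * \<i> * (of_int m' ^ 2 * moebius \<tau> + 2 * of_int m' * (z / Jt)) =
      - pi * \<i> * of_int k + - pi * \<i> * (of_int m ^ 2 * \<tau> + 2 * of_int m * z) + heat_exponent \<tau> * z\<^sup>2"
  proof -
    have "of_int c * (z + of_int m * \<tau> + of_int n)\<^sup>2 + (of_int m' ^ 2 * (moebius \<tau> * Jt) + 2 * of_int m' * z) =
       (of_int k + (of_int m ^ 2 * \<tau> + 2 * of_int m * z)) * Jt + of_int c * z\<^sup>2"
      unfolding MJ unfolding Jt m'_def k_def of_int_mult of_int_diff of_int_add of_int_power of_int_numeral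
      using cdet by algebra
    then have "of_int c / Jt * (z + of_int m * \<tau> + of_int n)\<^sup>2 + (of_int m' ^ 2 * moebius \<tau> + 2 * of_int m' * (z / Jt)) =
       of_int k + (of_int m ^ 2 * \<tau> + 2 * of_int m * z) + of_int c / Jt * z\<^sup>2"
      using J0 by (simp add: field_simps)
    from arg_cong[OF this, of "\<lambda>x. - pi * \<i> * x"]
    show ?thesis unfolding heat_exponent_def Jt_def[symmetric] by (simp add: algebra_simps)
  qed
  have "exp (heat_exponent \<tau> * (z + of_int m * \<tau> + of_int n)\<^sup>2) * theta (moebius \<tau>) ((z + of_int m * \<tau> + of_int n) / Jt) =
     (-1) powi (m' + n') * exp (heat_exponent \<tau> * (z + of_int m * \<tau> + of_int n)\<^sup>2 +
       - pi * \<i> * (of_int m' ^ 2 * moebius \<tau> + 2 * of_int m' * (z / Jt))) * theta (moebius \<tau>) (z / Jt)"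
    unfolding arg theta_add_lattice exp_add by simp
  also have "\<dots> = (-1) powi (m' + n') * exp (- pi * \<i> * of_int k) *
      exp (- pi * \<i> * (of_int m ^ 2 * \<tau> + 2 * of_int m * z)) * (exp (heat_exponent \<tau> * z\<^sup>2) * theta (moebius \<tau>) (z / Jt))"
    unfolding e exp_add by simp
  finally show ?thesis
    unfolding Jt_def[symmetric] by (simp add: norm_mult norm_power_int norm_exp_eq_Re[of "- (pi * \<i> * of_int k)"])
qed

lemma theta_transform_const:
  assumes \<tau>: "Im \<tau> > 0"
  shows "\<exists>C. \<forall>z. exp (heat_exponent \<tau> * z\<^sup>2) * theta (moebius \<tau>) (z / cocycle \<tau>) = C * theta \<tau> z"
proof (rule entire_multiple_of_theta[OF \<tau>])
  have "(theta (moebius \<tau>) \<circ> (\<lambda>z. z / cocycle \<tau>)) holomorphic_on UNIV"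
    using cocycle_nonzero[OF \<tau>] 
    by (intro holomorphic_on_compose_gen[OF _ theta_holomorphic[OF Im_moebius[OF \<tau>]]]) (auto intro!: holomorphic_intros)
  then show "(\<lambda>z. exp (heat_exponent \<tau> * z\<^sup>2) * theta (moebius \<tau>) (z / cocycle \<tau>)) holomorphic_on UNIV"
    by (intro holomorphic_intros) (simp add: o_def)
  show "exp (heat_exponent \<tau> * 0\<^sup>2) * theta (moebius \<tau>) (0 / cocycle \<tau>) = 0" by (simp add: theta_0)
qed (rule slash_quasi_periodic[OF \<tau>])

text \<open>The Taylor coefficients of order one and three at \<open>z = 0\<close> in the relation with the constant
  \<open>C\<close>.\<close>

lemma theta_transform_taylor:
  assumes \<tau>: "Im \<tau> > 0" and C: "\<And>z. exp (heat_exponent \<tau> * z\<^sup>2) * theta (moebius \<tau>) (z / cocycle \<tau>) = C * theta \<tau> z"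
  shows "theta_moment 1 (moebius \<tau>) 0 / cocycle \<tau> = C * theta_moment 1 \<tau> 0"
    and "(pi * \<i>)\<^sup>2 * theta_moment 3 (moebius \<tau>) 0 / cocycle \<tau> ^ 3 + 6 * heat_exponent \<tau> * theta_moment 1 (moebius \<tau>) 0 / cocycle \<tau> =
      C * (pi * \<i>)\<^sup>2 * theta_moment 3 \<tau> 0"
proof -
  define E where "E z = exp (heat_exponent \<tau> * z\<^sup>2)" for z
  define T where "T k z = theta_moment k (moebius \<tau>) (z / cocycle \<tau>)" for k z
  define p where "p = pi * \<i> / cocycle \<tau>"
  define k where "k = heat_exponent \<tau>"
  note J0 = cocycle_nonzero[OF \<tau>]
  have dE: "(E has_field_derivative 2 * k * z * E z) (at z)" for z
    unfolding E_def k_def by (auto intro!: derivative_eq_intros)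
  have dT: "(T j has_field_derivative p * T (Suc j) z) (at z)" for j z
  proof -
    have "((\<lambda>z. z / cocycle \<tau>) has_field_derivative 1 / cocycle \<tau>) (at z)"
      using J0 by (auto intro!: derivative_eq_intros)
    from DERIV_chain2[OF theta_moment_has_field_derivative_z[OF Im_moebius[OF \<tau>]] this]
    show ?thesis by (simp add: T_def[abs_def] p_def)
  qed
  have dR: "((\<lambda>z. C * (pi * \<i>) ^ j * theta_moment j \<tau> z) has_field_derivative
      C * (pi * \<i>) ^ Suc j * theta_moment (Suc j) \<tau> z) (at z)" for j z
    using DERIV_cmult[OF theta_moment_has_field_derivative_z[OF \<tau>], of "C * (pi * \<i>) ^ j"]
    by (simp add: mult_ac)
  note uniq = DERIV_unique[OF _ dR]
  have 0: "E z * T 0 z = C * (pi * \<i>) ^ 0 * theta_moment 0 \<tau> z" for z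
    using C by (simp add: E_def T_def theta_eq_moment)
  have 1: "E z * (2 * k * z * T 0 z + p * T 1 z) = C * (pi * \<i>) ^ Suc 0 * theta_moment (Suc 0) \<tau> z" for z
    by (rule uniq, unfold 0[symmetric], (rule derivative_eq_intros dE dT refl)+) (simp add: algebra_simps)
  have 2: "E z * ((2 * k + 4 * k\<^sup>2 * z\<^sup>2) * T 0 z + 4 * k * z * p * T 1 z + p\<^sup>2 * T 2 z) =
      C * (pi * \<i>) ^ Suc (Suc 0) * theta_moment (Suc (Suc 0)) \<tau> z" for z
    by (rule uniq, unfold 1[symmetric], (rule derivative_eq_intros dE dT refl)+)
      (simp add: algebra_simps power2_eq_square numeral_2_eq_2)
  have 3: "E z * ((12 * k\<^sup>2 * z + 8 * k ^ 3 * z ^ 3) * T 0 z + (6 * k + 12 * k\<^sup>2 * z\<^sup>2) * p * T 1 z +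
      6 * k * z * p\<^sup>2 * T 2 z + p ^ 3 * T 3 z) =
      C * (pi * \<i>) ^ Suc (Suc (Suc 0)) * theta_moment (Suc (Suc (Suc 0))) \<tau> z" for z
    by (rule uniq, unfold 2[symmetric], (rule derivative_eq_intros dE dT refl)+)
      (simp add: algebra_simps power2_eq_square power3_eq_cube numeral_2_eq_2 numeral_3_eq_3)
  have "pi * \<i> * (theta_moment 1 (moebius \<tau>) 0 / cocycle \<tau>) = pi * \<i> * (C * theta_moment 1 \<tau> 0)"
    using 1[of 0] by (simp add: E_def T_def p_def mult_ac)
  then show "theta_moment 1 (moebius \<tau>) 0 / cocycle \<tau> = C * theta_moment 1 \<tau> 0"
    by (subst (asm) mult_left_cancel) auto
  have "(pi * \<i>) * ((pi * \<i>)\<^sup>2 * theta_moment 3 (moebius \<tau>) 0 / cocycle \<tau> ^ 3 + 6 * heat_exponent \<tau> * theta_moment 1 (moebius \<tau>) 0 / cocycle \<tau>) =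
      (pi * \<i>) * (C * (pi * \<i>)\<^sup>2 * theta_moment 3 \<tau> 0)"
    using 3[of 0] by (simp add: E_def T_def p_def k_def power3_eq_cube power2_eq_square eval_nat_numeral algebra_simps)
  then show "(pi * \<i>)\<^sup>2 * theta_moment 3 (moebius \<tau>) 0 / cocycle \<tau> ^ 3 + 6 * heat_exponent \<tau> * theta_moment 1 (moebius \<tau>) 0 / cocycle \<tau> =
      C * (pi * \<i>)\<^sup>2 * theta_moment 3 \<tau> 0"
    by (subst (asm) mult_left_cancel) auto
qed

text \<open>The principal branch of \<open>(c\<tau> + d)\<^bsup>1/2\<^esup>\<close>. It is holomorphic on the upper half plane, since
  \<open>c\<tau> + d\<close> is not real there unless \<open>c = 0\<close>, in which case it is constant.\<close>

definition sqrt_cocycle :: "complex \<Rightarrow> complex" where "sqrt_cocycle \<tau> = cocycle \<tau> powr (1 / 2)"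

lemma sqrt_cocycle_square: "(sqrt_cocycle \<tau>)\<^sup>2 = cocycle \<tau>"
  by (cases "cocycle \<tau> = 0") (auto simp: sqrt_cocycle_def power2_eq_square powr_add[symmetric])

lemma sqrt_cocycle_nonzero: "Im \<tau> > 0 \<Longrightarrow> sqrt_cocycle \<tau> \<noteq> 0"
  using sqrt_cocycle_square[of \<tau>] cocycle_nonzero[of \<tau>] by auto

lemma sqrt_cocycle_has_field_derivative:
  assumes \<tau>: "Im \<tau> > 0"
  shows "(sqrt_cocycle has_field_derivative of_int c / (2 * sqrt_cocycle \<tau>)) (at \<tau>)"
proof (cases "c = 0")
  case True
  then have "sqrt_cocycle = (\<lambda>_. of_int d powr (1 / 2))" unfolding sqrt_cocycle_def[abs_def] cocycle_def by simp
  then show ?thesis using True by simp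
next
  case False
  have "cocycle \<tau> \<notin> \<real>\<^sub>\<le>\<^sub>0" using False \<tau> by (auto simp: complex_nonpos_Reals_iff cocycle_def)
  moreover have "(cocycle has_field_derivative of_int c) (at \<tau>)"
    unfolding cocycle_def by (auto intro!: derivative_eq_intros)
  ultimately have "((\<lambda>\<tau>. cocycle \<tau> powr (1 / 2)) has_field_derivative 1 / 2 * cocycle \<tau> powr (1 / 2 - 1) * of_int c) (at \<tau>)"
    using DERIV_chain2[OF has_field_derivative_powr] by blast
  moreover have "cocycle \<tau> powr (1 / 2 - 1) = inverse (sqrt_cocycle \<tau>)"
    unfolding powr_minus[symmetric] sqrt_cocycle_def by simp
  ultimately show ?thesis
    by (simp add: sqrt_cocycle_def[abs_def] field_simps)
qed

lemma moebius_has_field_derivative: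
  assumes \<tau>: "Im \<tau> > 0"
  shows "(moebius has_field_derivative 1 / (cocycle \<tau>)\<^sup>2) (at \<tau>)"
proof -
  have j: "(cocycle has_field_derivative of_int c) (at \<tau>)"
    unfolding cocycle_def by (auto intro!: derivative_eq_intros)
  have "(moebius has_field_derivative (of_int a * cocycle \<tau> - (of_int a * \<tau> + of_int b) * of_int c) / (cocycle \<tau> * cocycle \<tau>)) (at \<tau>)"
    unfolding moebius_def by (rule derivative_eq_intros j refl cocycle_nonzero[OF \<tau>] | simp)+
  also have "of_int a * cocycle \<tau> - (of_int a * \<tau> + of_int b) * of_int c = 1"
    unfolding cocycle_def using cdet by algebra
  finally show ?thesis by (simp add: power2_eq_square)
qed

text \<open>The \<open>\<tau>\<close>-derivative of Jacobi's derivative formula, rewritten by the heat equation.\<close>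

lemma theta_moment_3_eq:
  assumes \<tau>: "Im \<tau> > 0"
  shows "pi * \<i> / 4 * theta_moment 3 \<tau> 0 = 6 * dedekind_eta \<tau> ^ 2 * deriv dedekind_eta \<tau>"
proof -
  have op: "open {\<tau>. Im \<tau> > 0}" by (rule open_halfspace_Im_gt)
  have "((\<lambda>\<tau>. 2 * dedekind_eta \<tau> ^ 3) has_field_derivative 6 * dedekind_eta \<tau> ^ 2 * deriv dedekind_eta \<tau>) (at \<tau>)"
    by (rule derivative_eq_intros refl holomorphic_derivI[OF dedekind_eta_holomorphic op] | use \<tau> in simp)+
  then have "((\<lambda>\<tau>. theta_moment 1 \<tau> 0) has_field_derivative 6 * dedekind_eta \<tau> ^ 2 * deriv dedekind_eta \<tau>) (at \<tau>)"
    by (rule has_field_derivative_transform_within_open[OF _ op])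
      (use \<tau> theta_moment_1_eq_eta_cubed in auto)
  moreover have "((\<lambda>\<tau>. theta_moment 1 \<tau> 0) has_field_derivative pi * \<i> / 4 * theta_moment 3 \<tau> 0) (at \<tau>)"
    using theta_moment_has_field_derivative_tau[OF \<tau>, of 1 0] by (simp add: numeral_3_eq_3)
  ultimately show ?thesis by (rule DERIV_unique[symmetric])
qed

text \<open>Eliminating \<open>C\<close> from the two Taylor coefficients gives the transformation of the logarithmic
  derivative of \<open>\<eta>\<close>.\<close>

lemma eta_deriv_transform:
  assumes \<tau>: "Im \<tau> > 0"
  shows "deriv dedekind_eta (moebius \<tau>) / (cocycle \<tau>)\<^sup>2 =
    dedekind_eta (moebius \<tau>) * deriv dedekind_eta \<tau> / dedekind_eta \<tau> + of_int c * dedekind_eta (moebius \<tau>) / (2 * cocycle \<tau>)"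
proof -
  obtain C where C: "\<And>z. exp (heat_exponent \<tau> * z\<^sup>2) * theta (moebius \<tau>) (z / cocycle \<tau>) = C * theta \<tau> z"
    using theta_transform_const[OF \<tau>] by blast
  define e where "e = dedekind_eta \<tau>"
  define e1 where "e1 = deriv dedekind_eta \<tau>"
  define E where "E = dedekind_eta (moebius \<tau>)"
  define E1 where "E1 = deriv dedekind_eta (moebius \<tau>)"
  define j where "j = cocycle \<tau>"
  define t where "t = theta_moment 3 \<tau> 0"
  define T where "T = theta_moment 3 (moebius \<tau>) 0"
  have nz: "e \<noteq> 0" "E \<noteq> 0" "j \<noteq> 0"
    using \<tau> Im_moebius by (auto simp: e_def E_def j_def dedekind_eta_nonzero cocycle_nonzero)
  have 1: "2 * E ^ 3 / j = C * (2 * e ^ 3)"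
    using theta_transform_taylor(1)[OF \<tau> C] \<tau> Im_moebius[OF \<tau>]
    by (simp add: theta_moment_1_eq_eta_cubed[unfolded One_nat_def] e_def E_def j_def)
  then have C': "C = E ^ 3 / (j * e ^ 3)" using nz by (simp add: field_simps)
  have 2: "(pi * \<i>)\<^sup>2 * T / j ^ 3 + 6 * (- pi * \<i> * of_int c / j) * (2 * E ^ 3) / j = C * (pi * \<i>)\<^sup>2 * t"
    using theta_transform_taylor(2)[OF \<tau> C] Im_moebius[OF \<tau>]
    by (simp add: theta_moment_1_eq_eta_cubed[unfolded One_nat_def] E_def j_def T_def t_def heat_exponent_def)
  have t: "pi * \<i> * t = 24 * e ^ 2 * e1" and T: "pi * \<i> * T = 24 * E ^ 2 * E1"
    using theta_moment_3_eq[OF \<tau>] theta_moment_3_eq[OF Im_moebius[OF \<tau>]]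
    by (auto simp: t_def T_def e_def E_def e1_def E1_def field_simps)
  have "(pi * \<i>) * ((pi * \<i> * T) / j ^ 3 - 12 * of_int c * E ^ 3 / j\<^sup>2) = (pi * \<i>) * (C * (pi * \<i> * t))"
    using 2 by (simp add: power2_eq_square algebra_simps)
  then have "(pi * \<i> * T) / j ^ 3 - 12 * of_int c * E ^ 3 / j\<^sup>2 = C * (pi * \<i> * t)"
    by (subst (asm) mult_left_cancel) auto
  then have "24 * E ^ 2 * E1 / j ^ 3 - 12 * of_int c * E ^ 3 / j\<^sup>2 = E ^ 3 / (j * e ^ 3) * (24 * e ^ 2 * e1)"
    unfolding t T C' .
  then have "24 * E ^ 2 * E1 / j ^ 3 = E ^ 3 / (j * e ^ 3) * (24 * e ^ 2 * e1) + 12 * of_int c * E ^ 3 / j\<^sup>2"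
    by (simp only: diff_eq_eq)
  moreover have "24 * E ^ 2 * E1 / j ^ 3 = (24 * E ^ 2 / j) * (E1 / j\<^sup>2)"
    using nz by (simp add: power2_eq_square power3_eq_cube)
  moreover have "E ^ 3 / (j * e ^ 3) * (24 * e ^ 2 * e1) + 12 * of_int c * E ^ 3 / j\<^sup>2 =
      (24 * E ^ 2 / j) * (E * e1 / e + of_int c * E / (2 * j))"
    using nz by (simp add: power2_eq_square power3_eq_cube field_simps)
  ultimately have "(24 * E ^ 2 / j) * (E1 / j\<^sup>2) = (24 * E ^ 2 / j) * (E * e1 / e + of_int c * E / (2 * j))"
    by (simp only:)
  then have "E1 / j\<^sup>2 = E * e1 / e + of_int c * E / (2 * j)"
    by (subst (asm) mult_left_cancel) (use nz in auto)
  then show ?thesis by (simp add: E1_def E_def e_def e1_def j_def)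
qed

text \<open>The previous lemma says that \<open>\<eta>(A\<tau>) / ((c\<tau> + d)\<^bsup>1/2\<^esup> \<eta>(\<tau>))\<close> has derivative zero.\<close>

lemma eta_transform_exists:
  "\<exists>v. \<forall>\<tau>. Im \<tau> > 0 \<longrightarrow> dedekind_eta (moebius \<tau>) = v * sqrt_cocycle \<tau> * dedekind_eta \<tau>"
proof -
  define h where "h \<tau> = dedekind_eta (moebius \<tau>) / (sqrt_cocycle \<tau> * dedekind_eta \<tau>)" for \<tau>
  have op: "open {\<tau>. Im \<tau> > 0}" by (rule open_halfspace_Im_gt)
  have dh: "(h has_field_derivative 0) (at \<tau> within {\<tau>. Im \<tau> > 0})" if "\<tau> \<in> {\<tau>. Im \<tau> > 0}" for \<tau>
  proof -
    have \<tau>: "Im \<tau> > 0" using that by simp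
    have nz: "dedekind_eta \<tau> \<noteq> 0" "sqrt_cocycle \<tau> \<noteq> 0" "cocycle \<tau> \<noteq> 0"
      using \<tau> by (auto simp: dedekind_eta_nonzero sqrt_cocycle_nonzero cocycle_nonzero)
    have de: "(dedekind_eta has_field_derivative deriv dedekind_eta w) (at w)" if "Im w > 0" for w
      using that by (intro holomorphic_derivI[OF dedekind_eta_holomorphic op]) simp
    have dM: "((\<lambda>\<tau>. dedekind_eta (moebius \<tau>)) has_field_derivative
        deriv dedekind_eta (moebius \<tau>) * (1 / (cocycle \<tau>)\<^sup>2)) (at \<tau>)"
      by (rule DERIV_chain2[OF de[OF Im_moebius[OF \<tau>]] moebius_has_field_derivative[OF \<tau>]])
    have eq: "deriv dedekind_eta (moebius \<tau>) * (1 / (cocycle \<tau>)\<^sup>2) * (sqrt_cocycle \<tau> * dedekind_eta \<tau>) =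
        dedekind_eta (moebius \<tau>) * (of_int c / (2 * sqrt_cocycle \<tau>) * dedekind_eta \<tau> + deriv dedekind_eta \<tau> * sqrt_cocycle \<tau>)"
    proof -
      have "deriv dedekind_eta (moebius \<tau>) * (1 / (cocycle \<tau>)\<^sup>2) = deriv dedekind_eta (moebius \<tau>) / (cocycle \<tau>)\<^sup>2" by simp
      also note eta_deriv_transform[OF \<tau>]
      finally show ?thesis using nz
        by (simp add: sqrt_cocycle_square[symmetric] field_simps power2_eq_square)
    qed
    have "(h has_field_derivative
       (deriv dedekind_eta (moebius \<tau>) * (1 / (cocycle \<tau>)\<^sup>2) * (sqrt_cocycle \<tau> * dedekind_eta \<tau>) -
         dedekind_eta (moebius \<tau>) * (of_int c / (2 * sqrt_cocycle \<tau>) * dedekind_eta \<tau> + deriv dedekind_eta \<tau> * sqrt_cocycle \<tau>)) /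
       ((sqrt_cocycle \<tau> * dedekind_eta \<tau>) * (sqrt_cocycle \<tau> * dedekind_eta \<tau>))) (at \<tau>)"
      unfolding h_def
      by (rule DERIV_divide[OF dM DERIV_mult[OF sqrt_cocycle_has_field_derivative[OF \<tau>] de[OF \<tau>]]])
        (use nz in auto)
    then have "(h has_field_derivative 0) (at \<tau>)" unfolding eq by simp
    then show ?thesis by (rule has_field_derivative_at_within)
  qed
  obtain v where v: "\<And>\<tau>. Im \<tau> > 0 \<Longrightarrow> h \<tau> = v"
    using has_field_derivative_zero_constant[OF convex_halfspace_Im_gt dh] by auto
  have "dedekind_eta (moebius \<tau>) = v * sqrt_cocycle \<tau> * dedekind_eta \<tau>" if "Im \<tau> > 0" for \<tau>
    using v[OF that] sqrt_cocycle_nonzero[OF that] dedekind_eta_nonzero[OF that]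
    by (simp add: h_def field_simps)
  then show ?thesis by blast
qed

lemma eta_transform:
  assumes \<tau>: "Im \<tau> > 0"
  shows "dedekind_eta (moebius \<tau>) = v_eta a b c d * sqrt_cocycle \<tau> * dedekind_eta \<tau>"
proof -
  obtain v where v: "\<And>\<tau>. Im \<tau> > 0 \<Longrightarrow> dedekind_eta (moebius \<tau>) = v * sqrt_cocycle \<tau> * dedekind_eta \<tau>"
    using eta_transform_exists by blast
  have "v_eta a b c d = v"
    unfolding v_eta_def
  proof (rule the_equality)
    show "\<forall>\<tau>\<in>upper_half. dedekind_eta ((of_int a * \<tau> + of_int b) / (of_int c * \<tau> + of_int d)) =
        v * (of_int c * \<tau> + of_int d) powr (1 / 2) * dedekind_eta \<tau>"
      using v by (auto simp: upper_half_def moebius_def cocycle_def sqrt_cocycle_def)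
    fix w assume "\<forall>\<tau>\<in>upper_half. dedekind_eta ((of_int a * \<tau> + of_int b) / (of_int c * \<tau> + of_int d)) =
        w * (of_int c * \<tau> + of_int d) powr (1 / 2) * dedekind_eta \<tau>"
    then have "dedekind_eta (moebius \<tau>) = w * sqrt_cocycle \<tau> * dedekind_eta \<tau>"
      using \<tau> by (auto simp: upper_half_def moebius_def cocycle_def sqrt_cocycle_def)
    then show "w = v"
      using v[OF \<tau>] sqrt_cocycle_nonzero[OF \<tau>] dedekind_eta_nonzero[OF \<tau>] by simp
  qed
  then show ?thesis using v[OF \<tau>] by simp
qed

lemma v_eta_nonzero: "v_eta a b c d \<noteq> 0"
  using eta_transform[of \<i>] dedekind_eta_nonzero[OF Im_moebius[of \<i>]] by auto

text \<open>The first Taylor coefficient now determines \<open>C\<close>, so that \<open>\<vartheta>\<close> has the multiplier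
  \<open>v\<^sub>\<eta>\<^sup>3\<close>.\<close>

lemma theta_transform:
  assumes \<tau>: "Im \<tau> > 0"
  shows "theta (moebius \<tau>) (z / cocycle \<tau>) =
    v_eta a b c d ^ 3 * sqrt_cocycle \<tau> * exp (pi * \<i> * of_int c * z\<^sup>2 / cocycle \<tau>) * theta \<tau> z"
proof -
  obtain C where C: "\<And>z. exp (heat_exponent \<tau> * z\<^sup>2) * theta (moebius \<tau>) (z / cocycle \<tau>) = C * theta \<tau> z"
    using theta_transform_const[OF \<tau>] by blast
  have nz: "dedekind_eta \<tau> \<noteq> 0" "sqrt_cocycle \<tau> \<noteq> 0" "cocycle \<tau> \<noteq> 0"
    using \<tau> by (auto simp: dedekind_eta_nonzero sqrt_cocycle_nonzero cocycle_nonzero)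
  have "2 * dedekind_eta (moebius \<tau>) ^ 3 / cocycle \<tau> = C * (2 * dedekind_eta \<tau> ^ 3)"
    using theta_transform_taylor(1)[OF \<tau> C] \<tau> Im_moebius[OF \<tau>]
    by (simp add: theta_moment_1_eq_eta_cubed[unfolded One_nat_def])
  then have "C = v_eta a b c d ^ 3 * sqrt_cocycle \<tau>"
    unfolding eta_transform[OF \<tau>] using nz
    by (simp add: sqrt_cocycle_square[symmetric] field_simps power2_eq_square power3_eq_cube)
  moreover have "theta (moebius \<tau>) (z / cocycle \<tau>) = exp (- (heat_exponent \<tau> * z\<^sup>2)) * (exp (heat_exponent \<tau> * z\<^sup>2) * theta (moebius \<tau>) (z / cocycle \<tau>))"
    by (simp add: exp_minus)
  moreover have "- (heat_exponent \<tau> * z\<^sup>2) = pi * \<i> * of_int c * z\<^sup>2 / cocycle \<tau>"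
    by (simp add: heat_exponent_def)
  ultimately show ?thesis using C[of z] by (simp add: mult_ac)
qed

end

section \<open>Transformation laws of the function on the lattice A2\<close>

lemma sigma_A2_apply:
  "sigma_A2 (\<tau>, Z) = theta \<tau> (Z $ 1) * theta \<tau> (Z $ 2) * theta \<tau> (Z $ 1 + Z $ 2) / dedekind_eta \<tau>"
  by (simp add: sigma_A2_def)

lemma cform_3: "cform z w = z $ 1 * w $ 1 + z $ 2 * w $ 2 + z $ 3 * w $ 3" for z w :: "complex ^ 3"
  by (simp add: cform_def sum_3)

text \<open>Three factors \<open>\<vartheta>\<close> over one \<open>\<eta>\<close> give the multiplier \<open>v\<^sub>\<eta>\<^bsup>9-1\<^esup>\<close> and the weight
  \<open>(3 - 1) / 2 = 1\<close>.\<close>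

lemma sigma_A2_modular:
  fixes Z :: "complex ^ 3"
  assumes det: "a * d - b * c = 1" and \<tau>: "Im \<tau> > 0" and Z: "Z $ 3 = - (Z $ 1 + Z $ 2)"
  shows "sigma_A2 ((of_int a * \<tau> + of_int b) / (of_int c * \<tau> + of_int d), (1 / (of_int c * \<tau> + of_int d)) *s Z) =
    v_eta a b c d powi 8 * (of_int c * \<tau> + of_int d) powr (of_real 1) *
      exp (pi * \<i> * (of_int c * cform Z Z / (of_int c * \<tau> + of_int d))) * sigma_A2 (\<tau>, Z)"
proof -
  define j where "j = of_int c * \<tau> + of_int d"
  define A where "A = (of_int a * \<tau> + of_int b) / j"
  define s where "s = sqrt_cocycle c d \<tau>"
  define v where "v = v_eta a b c d"
  have c: "cocycle c d \<tau> = j" "moebius a b c d \<tau> = A"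
    by (simp_all add: cocycle_def[OF det] moebius_def[OF det] j_def A_def)
  have th: "theta A (z / j) = v ^ 3 * s * exp (pi * \<i> * of_int c * z\<^sup>2 / j) * theta \<tau> z" for z
    using theta_transform[OF det \<tau>, of z] by (simp add: c s_def v_def)
  have et: "dedekind_eta A = v * s * dedekind_eta \<tau>"
    using eta_transform[OF det \<tau>] by (simp add: c s_def v_def)
  have nz: "j \<noteq> 0" "s \<noteq> 0" "v \<noteq> 0" and s2: "s\<^sup>2 = j"
    using cocycle_nonzero[OF det \<tau>] sqrt_cocycle_nonzero[OF det \<tau>] v_eta_nonzero[OF det]
      sqrt_cocycle_square[OF det, of \<tau>]
    by (auto simp: c s_def v_def)
  have e: "exp (pi * \<i> * (of_int c * cform Z Z / j)) =
      exp (pi * \<i> * of_int c * (Z $ 1)\<^sup>2 / j) * exp (pi * \<i> * of_int c * (Z $ 2)\<^sup>2 / j) *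
      exp (pi * \<i> * of_int c * (Z $ 1 + Z $ 2)\<^sup>2 / j)"
    unfolding exp_add[symmetric]
    by (rule arg_cong[where f = exp]) (use nz in \<open>simp add: cform_3 Z field_simps power2_eq_square\<close>)
  define E1 where "E1 = exp (pi * \<i> * of_int c * (Z $ 1)\<^sup>2 / j)"
  define E2 where "E2 = exp (pi * \<i> * of_int c * (Z $ 2)\<^sup>2 / j)"
  define E3 where "E3 = exp (pi * \<i> * of_int c * (Z $ 1 + Z $ 2)\<^sup>2 / j)"
  have "sigma_A2 (A, (1 / j) *s Z) =
      theta A (Z $ 1 / j) * theta A (Z $ 2 / j) * theta A ((Z $ 1 + Z $ 2) / j) / dedekind_eta A"
    by (simp add: sigma_A2_apply add_divide_distrib)
  also have "\<dots> = (v ^ 3 * s * E1 * theta \<tau> (Z $ 1)) * (v ^ 3 * s * E2 * theta \<tau> (Z $ 2)) *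
      (v ^ 3 * s * E3 * theta \<tau> (Z $ 1 + Z $ 2)) / (v * s * dedekind_eta \<tau>)"
    unfolding th et E1_def E2_def E3_def ..
  also have "\<dots> = (v ^ 9 / v) * (s ^ 3 / s) * (E1 * E2 * E3) * sigma_A2 (\<tau>, Z)"
    by (simp add: sigma_A2_apply power_numeral_reduce)
  also have "v ^ 9 / v = v powi 8"
    using nz by (simp add: power_numeral_reduce)
  also have "s ^ 3 / s = j powr (of_real 1)"
    using nz by (simp add: s2[symmetric] power_numeral_reduce)
  finally show ?thesis
    unfolding e[folded j_def] E1_def[symmetric] E2_def[symmetric] E3_def[symmetric] j_def[symmetric]
      A_def[symmetric] v_def[symmetric] .
qed

lemma sigma_A2_elliptic:
  fixes Z :: "complex ^ 3"
  assumes x: "x \<in> A2_lattice" and y: "y \<in> A2_lattice" and Z: "Z $ 3 = - (Z $ 1 + Z $ 2)"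
  shows "sigma_A2 (\<tau>, Z + \<tau> *s cvec x + cvec y) =
    exp (- pi * \<i> * (of_real (x \<bullet> x) * \<tau> + 2 * cform (cvec x) Z)) * sigma_A2 (\<tau>, Z)"
proof -
  obtain m1 m2 n1 n2 :: int where mn: "x $ 1 = of_int m1" "x $ 2 = of_int m2" "y $ 1 = of_int n1" "y $ 2 = of_int n2"
    using x y unfolding A2_lattice_def mem_Collect_eq by (meson Ints_cases)
  have x3: "x $ 3 = - of_int (m1 + m2)"
    using x mn by (simp add: A2_lattice_def)
  have t3: "theta \<tau> ((Z $ 1 + of_int m1 * \<tau> + of_int n1) + (Z $ 2 + of_int m2 * \<tau> + of_int n2)) =
     (-1) powi ((m1 + m2) + (n1 + n2)) *
       exp (- pi * \<i> * (of_int (m1 + m2) ^ 2 * \<tau> + 2 * of_int (m1 + m2) * (Z $ 1 + Z $ 2))) * theta \<tau> (Z $ 1 + Z $ 2)"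
    using theta_add_lattice[of \<tau> "Z $ 1 + Z $ 2" "m1 + m2" "n1 + n2"] by (simp add: algebra_simps)
  define E where "E m z = exp (- pi * \<i> * (of_int m ^ 2 * \<tau> + 2 * of_int m * z))" for m :: int and z
  have e: "E m1 (Z $ 1) * E m2 (Z $ 2) * E (m1 + m2) (Z $ 1 + Z $ 2) =
      exp (- pi * \<i> * (of_real (x \<bullet> x) * \<tau> + 2 * cform (cvec x) Z))"
    unfolding E_def exp_add[symmetric]
    by (rule arg_cong[where f = exp])
      (simp add: cform_3 cvec_def inner_vec_def sum_3 mn x3 Z algebra_simps power2_eq_square)
  have sgn: "((-1) powi (m1 + n1) * (-1) powi (m2 + n2) * (-1) powi ((m1 + m2) + (n1 + n2)) :: complex) = 1"
  proof -
    have "((-1) powi (m1 + n1) * (-1) powi (m2 + n2) * (-1) powi ((m1 + m2) + (n1 + n2)) :: complex) =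
        (-1) powi (2 * (m1 + m2 + n1 + n2))"
      by (simp flip: power_int_add)
    also have "\<dots> = 1" by (simp add: power_int_mult)
    finally show ?thesis .
  qed
  have "sigma_A2 (\<tau>, Z + \<tau> *s cvec x + cvec y) =
      theta \<tau> (Z $ 1 + of_int m1 * \<tau> + of_int n1) * theta \<tau> (Z $ 2 + of_int m2 * \<tau> + of_int n2) *
      theta \<tau> ((Z $ 1 + of_int m1 * \<tau> + of_int n1) + (Z $ 2 + of_int m2 * \<tau> + of_int n2)) / dedekind_eta \<tau>"
    by (simp add: sigma_A2_apply cvec_def mn mult.commute)
  also have "\<dots> = ((-1) powi (m1 + n1) * (-1) powi (m2 + n2) * (-1) powi ((m1 + m2) + (n1 + n2))) *
      (E m1 (Z $ 1) * E m2 (Z $ 2) * E (m1 + m2) (Z $ 1 + Z $ 2)) * sigma_A2 (\<tau>, Z)"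
    unfolding t3 theta_add_lattice E_def[symmetric] sigma_A2_apply by (simp add: mult_ac)
  finally show ?thesis unfolding sgn e by simp
qed

section \<open>Joint holomorphy\<close>

text \<open>Differentiability at a point with complex linear derivative.\<close>

definition complex_differentiable_at ::
    "(complex \<times> (complex ^ 'n) \<Rightarrow> complex) \<Rightarrow> complex \<times> (complex ^ 'n) \<Rightarrow> bool" where
  "complex_differentiable_at f x \<longleftrightarrow>
     (\<exists>D. (f has_derivative D) (at x) \<and> (\<forall>c v w. D (c * v, c *s w) = c * D (v, w)))"

lemma complex_differentiable_mult:
  assumes "complex_differentiable_at f x" "complex_differentiable_at g x"
  shows "complex_differentiable_at (\<lambda>y. f y * g y) x"
proof -
  obtain D D' where D: "(f has_derivative D) (at x)" "\<And>c v w. D (c * v, c *s w) = c * D (v, w)"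
    and D': "(g has_derivative D') (at x)" "\<And>c v w. D' (c * v, c *s w) = c * D' (v, w)"
    using assms unfolding complex_differentiable_at_def by auto
  show ?thesis
    unfolding complex_differentiable_at_def
    by (rule exI, rule conjI, rule has_derivative_mult[OF D(1) D'(1)])
      (simp add: D(2) D'(2) algebra_simps)
qed

lemma complex_differentiable_theta:
  fixes l :: "complex ^ 'n \<Rightarrow> complex"
  assumes "bounded_linear l" "\<And>c w. l (c *s w) = c * l w" "Im (fst x) > 0"
  shows "complex_differentiable_at (\<lambda>(\<tau>, Z). theta \<tau> (l Z)) x"
proof -
  obtain \<tau> Z where x: "x = (\<tau>, Z)" by fastforce
  have "((\<lambda>y. (fst y, l (snd y))) has_derivative (\<lambda>y. (fst y, l (snd y)))) (at x)"
    by (intro bounded_linear_imp_has_derivative bounded_linear_Pair bounded_linear_fst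
        bounded_linear_compose[OF assms(1) bounded_linear_snd])
  moreover have "((\<lambda>(\<tau>, z). theta_moment 0 \<tau> z) has_derivative
     (\<lambda>(h, w). pi * \<i> / 4 * theta_moment (0 + 2) \<tau> (l Z) * h + pi * \<i> * theta_moment (0 + 1) \<tau> (l Z) * w))
     (at (fst x, l (snd x)))"
    using theta_moment_has_derivative[of \<tau> 0 "l Z"] assms(3) by (simp add: x)
  ultimately have "((\<lambda>y. (\<lambda>(\<tau>, z). theta_moment 0 \<tau> z) (fst y, l (snd y))) has_derivative
     (\<lambda>y. (\<lambda>(h, w). pi * \<i> / 4 * theta_moment (0 + 2) \<tau> (l Z) * h + pi * \<i> * theta_moment (0 + 1) \<tau> (l Z) * w)
       (fst y, l (snd y)))) (at x)"
    by (rule has_derivative_compose)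
  then have "((\<lambda>(\<tau>, Z). theta \<tau> (l Z)) has_derivative
     (\<lambda>y. pi * \<i> / 4 * theta_moment 2 \<tau> (l Z) * fst y + pi * \<i> * theta_moment 1 \<tau> (l Z) * l (snd y))) (at x)"
    by (simp add: theta_eq_moment case_prod_beta' numeral_2_eq_2)
  then show ?thesis
    unfolding complex_differentiable_at_def
    by (intro exI conjI) (assumption, simp add: assms(2) algebra_simps)
qed

lemma complex_differentiable_inverse_eta:
  assumes "Im (fst x) > 0"
  shows "complex_differentiable_at (\<lambda>(\<tau>, Z). inverse (dedekind_eta \<tau>)) x"
proof -
  define g' where "g' = deriv (\<lambda>\<tau>. inverse (dedekind_eta \<tau>)) (fst x)"
  have "(\<lambda>\<tau>. inverse (dedekind_eta \<tau>)) holomorphic_on {\<tau>. Im \<tau> > 0}"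
    by (intro holomorphic_intros dedekind_eta_holomorphic) (auto simp: dedekind_eta_nonzero)
  then have "((\<lambda>\<tau>. inverse (dedekind_eta \<tau>)) has_field_derivative g') (at (fst x))"
    unfolding g'_def by (rule holomorphic_derivI[OF _ open_halfspace_Im_gt]) (use assms in simp)
  then have "((\<lambda>\<tau>. inverse (dedekind_eta \<tau>)) has_derivative (\<lambda>h. g' * h)) (at (fst x))"
    by (simp add: has_field_derivative_def)
  from has_derivative_compose[OF bounded_linear_imp_has_derivative[OF bounded_linear_fst] this]
  have "((\<lambda>(\<tau>, Z). inverse (dedekind_eta \<tau>)) has_derivative (\<lambda>h. g' * fst h)) (at x)"
    unfolding case_prod_beta' .
  then show ?thesis
    unfolding complex_differentiable_at_def by (intro exI conjI) (assumption, simp)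
qed

lemma sigma_A2_complex_differentiable:
  assumes "Im (fst x) > 0"
  shows "complex_differentiable_at sigma_A2 x"
proof -
  have "complex_differentiable_at (\<lambda>y. (\<lambda>(\<tau>, Z). theta \<tau> (Z $ 1)) y * (\<lambda>(\<tau>, Z). theta \<tau> (Z $ 2)) y *
      (\<lambda>(\<tau>, Z). theta \<tau> (Z $ 1 + Z $ 2)) y * (\<lambda>(\<tau>, Z). inverse (dedekind_eta \<tau>)) y) x"
    by (intro complex_differentiable_mult complex_differentiable_theta complex_differentiable_inverse_eta
        bounded_linear_add bounded_linear_vec_nth assms) (auto simp: algebra_simps)
  moreover have "(\<lambda>y. (\<lambda>(\<tau>, Z). theta \<tau> (Z $ 1)) y * (\<lambda>(\<tau>, Z). theta \<tau> (Z $ 2)) y *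
      (\<lambda>(\<tau>, Z). theta \<tau> (Z $ 1 + Z $ 2)) y * (\<lambda>(\<tau>, Z). inverse (dedekind_eta \<tau>)) y) = sigma_A2"
    by (simp add: fun_eq_iff sigma_A2_def divide_inverse)
  ultimately show ?thesis by simp
qed

lemma holomorphic_within_restrict_sigma_A2:
  assumes "S \<subseteq> upper_half \<times> UNIV"
  shows "holomorphic_within (restrict sigma_A2 S) S"
  unfolding holomorphic_within_def
proof
  fix x assume x: "x \<in> S"
  then have "Im (fst x) > 0" using assms by (auto simp: upper_half_def)
  then obtain D where D: "(sigma_A2 has_derivative D) (at x)" "\<forall>c v w. D (c * v, c *s w) = c * D (v, w)"
    using sigma_A2_complex_differentiable unfolding complex_differentiable_at_def by blast
  have "(restrict sigma_A2 S has_derivative D) (at x within S)"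
    by (rule has_derivative_transform[OF x _ has_derivative_at_withinI[OF D(1)]]) simp
  with D(2) show "\<exists>D. (restrict sigma_A2 S has_derivative D) (at x within S) \<and>
      (\<forall>c v w. D (c * v, c *s w) = c * D (v, w))" by blast
qed

section \<open>Products of unconditional sums and the expansion of the inverse of eta\<close>

lemma has_sum_times:
  fixes f :: "'a \<Rightarrow> complex" and g :: "'b \<Rightarrow> complex"
  assumes f: "(\<lambda>x. norm (f x)) summable_on A" "(f has_sum s) A"
    and g: "(\<lambda>x. norm (g x)) summable_on B" "(g has_sum t) B"
  shows "(\<lambda>(x, y). norm (f x * g y)) summable_on A \<times> B" "((\<lambda>(x, y). f x * g y) has_sum s * t) (A \<times> B)"
proof -
  have sm: "(\<lambda>z. norm (f (fst z) * g (snd z))) summable_on A \<times> B"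
  proof (rule summable_on_SigmaI[where g = "\<lambda>x. norm (f x) * infsum (\<lambda>y. norm (g y)) B"])
    show "((\<lambda>y. norm (f (fst (x, y)) * g (snd (x, y)))) has_sum norm (f x) * infsum (\<lambda>y. norm (g y)) B) B" for x
      using has_sum_cmult_right[OF has_sum_infsum[OF g(1)], of "norm (f x)"] by (simp add: norm_mult)
    show "(\<lambda>x. norm (f x) * infsum (\<lambda>y. norm (g y)) B) summable_on A"
      by (intro summable_on_cmult_left f)
  qed auto
  then show "(\<lambda>(x, y). norm (f x * g y)) summable_on A \<times> B" by (simp add: case_prod_beta')
  have "(\<lambda>(x, y). f x * g y) summable_on A \<times> B"
    using Infinite_Sum.abs_summable_summable[OF sm] by (simp add: case_prod_beta')
  then show "((\<lambda>(x, y). f x * g y) has_sum s * t) (A \<times> B)"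
    using has_sum_cmult_right[OF g(2)] has_sum_cmult_left[OF f(2)]
    by (intro has_sum_SigmaI[where g = "\<lambda>x. f x * t"]) auto
qed

text \<open>An unconditionally convergent sum may be grouped by the values of a function.\<close>

lemma has_sum_group_by:
  fixes g :: "'a \<Rightarrow> complex"
  assumes g: "(g has_sum S) X" and k: "k ` X \<subseteq> I"
  shows "((\<lambda>i. infsum g {x \<in> X. k x = i}) has_sum S) I"
proof -
  have inj: "inj_on (\<lambda>x. (k x, x)) X" by (auto simp: inj_on_def)
  have im: "(\<lambda>x. (k x, x)) ` X = Sigma I (\<lambda>i. {x \<in> X. k x = i})" using k by auto
  have "((\<lambda>(i, x). g x) has_sum S) (Sigma I (\<lambda>i. {x \<in> X. k x = i}))"
    unfolding im[symmetric] by (subst has_sum_reindex[OF inj]) (use g in \<open>simp add: o_def\<close>)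
  then show ?thesis
  proof (rule has_sum_SigmaD)
    show "((\<lambda>y. case (i, y) of (i, x) \<Rightarrow> g x) has_sum infsum g {x \<in> X. k x = i}) {x \<in> X. k x = i}" for i
      using summable_on_subset_banach[OF has_sum_imp_summable[OF g], of "{x \<in> X. k x = i}"] by simp
  qed
qed

text \<open>The expansion \<open>1/\<eta> = q\<^bsup>-1/24\<^esup> \<Sum> a(m) q\<^sup>m\<close>.\<close>

lemma inverse_eta_expansion:
  "\<exists>A :: nat \<Rightarrow> complex. \<forall>\<tau>. Im \<tau> > 0 \<longrightarrow>
     (\<lambda>m. norm (A m * exp (2 * pi * \<i> * ((of_nat m - 1 / 24) * \<tau>)))) summable_on UNIV \<and>
     ((\<lambda>m. A m * exp (2 * pi * \<i> * ((of_nat m - 1 / 24) * \<tau>))) has_sum inverse (dedekind_eta \<tau>)) UNIV"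
proof -
  define P where "P q = inverse (qpoch_inf q q)" for q
  define A where "A m = (deriv ^^ m) P 0 / fact m" for m
  have "P holomorphic_on ball 0 1"
    unfolding P_def by (intro holomorphic_intros qpoch_inf_diag_holomorphic) (auto simp: qpoch_inf_diag_nonzero)
  then have sums: "(\<lambda>m. A m * q ^ m) sums P q" if "norm q < 1" for q
    using holomorphic_power_series[of P 0 1 q] that by (simp add: A_def)
  have abs: "summable (\<lambda>m. norm (A m * q ^ m))" if q: "norm q < 1" for q
  proof (rule powser_insidea)
    have r: "0 \<le> (1 + norm q) / 2" "norm q < (1 + norm q) / 2" "(1 + norm q) / 2 < 1"
      using q norm_ge_zero[of q] by auto
    have "norm (of_real ((1 + norm q) / 2) :: complex) = (1 + norm q) / 2"
      unfolding norm_of_real using r(1) by (rule abs_of_nonneg)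
    then show "summable (\<lambda>m. A m * of_real ((1 + norm q) / 2) ^ m)"
        and "norm q < norm (of_real ((1 + norm q) / 2) :: complex)"
      using r sums_summable[OF sums] by metis+
  qed
  show ?thesis
  proof (intro exI[of _ A] allI impI conjI)
    fix \<tau> :: complex assume \<tau>: "Im \<tau> > 0"
    define q where "q = exp (2 * pi * \<i> * \<tau>)"
    define c where "c = exp (- (pi * \<i> * \<tau> / 12))"
    have q: "norm q < 1" using norm_nome_less_1[OF \<tau>] by (simp add: q_def)
    have eq: "A m * exp (2 * pi * \<i> * ((of_nat m - 1 / 24) * \<tau>)) = c * (A m * q ^ m)" for m
    proof -
      have "exp (2 * pi * \<i> * ((of_nat m - 1 / 24) * \<tau>)) = c * q ^ m"
        unfolding c_def q_def exp_of_nat_mult[symmetric] exp_add[symmetric]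
        by (rule arg_cong[where f = exp]) (simp add: field_simps)
      then show ?thesis by simp
    qed
    have "(\<lambda>m. norm (A m * q ^ m)) summable_on UNIV"
      using abs[OF q] by (subst summable_on_UNIV_nonneg_real_iff) auto
    then show "(\<lambda>m. norm (A m * exp (2 * pi * \<i> * ((of_nat m - 1 / 24) * \<tau>)))) summable_on UNIV"
      unfolding eq norm_mult[of c] by (rule summable_on_cmult_right)
    have "((\<lambda>m. A m * q ^ m) has_sum P q) UNIV"
      by (rule norm_summable_imp_has_sum[OF abs[OF q] sums[OF q]])
    then have "((\<lambda>m. c * (A m * q ^ m)) has_sum c * P q) UNIV" by (rule has_sum_cmult_right)
    moreover have "c * P q = inverse (dedekind_eta \<tau>)"
      by (simp add: dedekind_eta_eq P_def c_def q_def exp_minus)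
    ultimately show "((\<lambda>m. A m * exp (2 * pi * \<i> * ((of_nat m - 1 / 24) * \<tau>))) has_sum inverse (dedekind_eta \<tau>)) UNIV"
      unfolding eq by simp
  qed
qed

section \<open>Sublattices of rank one\<close>

text \<open>The vector \<open>(p, q, - p - q)\<close> of \<open>A\<^sub>2\<close>, and the lattice that it generates.\<close>

definition A2_vec :: "int \<Rightarrow> int \<Rightarrow> real ^ 3" where
  "A2_vec p q = vector [of_int p, of_int q, - of_int (p + q)]"

definition A2_line :: "int \<Rightarrow> int \<Rightarrow> (real ^ 3) set" where
  "A2_line p q = range (\<lambda>t::int. of_int t *\<^sub>R A2_vec p q)"

lemma A2_vec_nth [simp]:
  "A2_vec p q $ 1 = of_int p" "A2_vec p q $ 2 = of_int q" "A2_vec p q $ 3 = - of_int (p + q)"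
  by (simp_all add: A2_vec_def vector_3)

text \<open>Half the norm of \<open>A2_vec p q\<close>.\<close>

definition half_norm :: "int \<Rightarrow> int \<Rightarrow> int" where
  "half_norm p q = p\<^sup>2 + p * q + q\<^sup>2"

lemma A2_vec_inner_self: "A2_vec p q \<bullet> A2_vec p q = 2 * of_int (half_norm p q)"
  by (simp add: inner_vec_def sum_3 half_norm_def power2_eq_square algebra_simps)

lemma half_norm_pos: "p \<noteq> 0 \<Longrightarrow> half_norm p q > 0"
proof -
  assume "p \<noteq> 0"
  then have "4 * half_norm p q > 0"
  proof -
    have "4 * half_norm p q = (2 * q + p)\<^sup>2 + 3 * p\<^sup>2"
      by (simp add: half_norm_def power2_eq_square algebra_simps)
    also have "\<dots> > 0" using \<open>p \<noteq> 0\<close> by (intro add_nonneg_pos) auto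
    finally show ?thesis .
  qed
  then show ?thesis by simp
qed

lemma A2_vec_nonzero: "p \<noteq> 0 \<Longrightarrow> A2_vec p q \<noteq> 0"
  by (metis A2_vec_nth(1) of_int_eq_0_iff zero_index)

lemma A2_line_subset: "A2_line p q \<subseteq> A2_lattice"
  by (auto simp: A2_line_def A2_lattice_def forall_3 algebra_simps)

lemma even_lattice_A2_line:
  assumes "p \<noteq> 0"
  shows "even_lattice (A2_line p q)"
  unfolding even_lattice_def int_lattice_def
proof (intro conjI ballI)
  have "independent {A2_vec p q}" using A2_vec_nonzero[OF assms] by simp
  moreover have "A2_line p q = {\<Sum>b\<in>{A2_vec p q}. of_int (c b) *\<^sub>R b | c :: real ^ 3 \<Rightarrow> int. True}"
    unfolding A2_line_def by auto
  ultimately show "\<exists>B. independent B \<and>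
      A2_line p q = {\<Sum>b\<in>B. of_int (c b) *\<^sub>R b | c :: real ^ 3 \<Rightarrow> int. True}" by blast
  fix x assume "x \<in> A2_line p q"
  then obtain t :: int where "x = of_int t *\<^sub>R A2_vec p q" by (auto simp: A2_line_def)
  then have "x \<bullet> x = 2 * of_int (t * t * half_norm p q)"
    by (simp add: A2_vec_inner_self)
  then show "\<exists>m::int. x \<bullet> x = 2 * of_int m" by blast
qed

lemma dim_A2_line:
  assumes "p \<noteq> 0"
  shows "dim (A2_line p q) = 1"
proof -
  have "span (A2_line p q) = span {A2_vec p q}"
  proof (rule span_eq[THEN iffD2], rule conjI)
    show "A2_line p q \<subseteq> span {A2_vec p q}"
      by (auto simp: A2_line_def intro: span_scale span_base)
    have "A2_vec p q \<in> A2_line p q" unfolding A2_line_def by (rule range_eqI[of _ _ 1]) simp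
    then show "{A2_vec p q} \<subseteq> span (A2_line p q)" by (simp add: span_base)
  qed
  then have "dim (A2_line p q) = dim {A2_vec p q}" by (metis dim_span)
  also have "\<dots> = 1" using A2_vec_nonzero[OF assms] by simp
  finally show ?thesis .
qed

lemma tensor_complex_A2_line:
  assumes "Z \<in> tensor_complex (A2_line p q)"
  obtains s where "Z = s *s cvec (A2_vec p q)"
proof -
  have "cvec ` A2_line p q \<subseteq> vec.span {cvec (A2_vec p q)}"
  proof
    fix y assume "y \<in> cvec ` A2_line p q"
    then obtain t :: int where "y = cvec (of_int t *\<^sub>R A2_vec p q)" by (auto simp: A2_line_def)
    then have "y = of_int t *s cvec (A2_vec p q)" by (simp add: cvec_def vec_eq_iff)
    then show "y \<in> vec.span {cvec (A2_vec p q)}" by (simp add: vec.span_scale vec.span_base)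
  qed
  then have "vec.span (cvec ` A2_line p q) \<subseteq> vec.span {cvec (A2_vec p q)}"
    by (rule vec.span_minimal) (rule vec.subspace_span)
  then show ?thesis
    using assms that unfolding tensor_complex_def vec.span_singleton by blast
qed

text \<open>The projection of \<open>u\<close> to \<open>A\<^sub>2 \<otimes> \<rat>\<close> is \<open>u\<close> minus the multiple of \<open>(1, 1, 1)\<close> that makes
  the coordinate sum zero; it has the same inner products with \<open>A\<^sub>2\<close> as \<open>u\<close>.\<close>

lemma A2_perp_eq_orthogonal:
  assumes u: "u = 2 *\<^sub>R vector [of_int u1, of_int u2, of_int u3]"
  shows "A2_perp u = {x \<in> A2_lattice. x $ 1 * of_int (u1 - u3) + x $ 2 * of_int (u2 - u3) = 0}"
proof -
  define V where "V = tensor_rat A2_lattice"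
  define \<sigma> where "\<sigma> = u1 + u2 + u3"
  define y0 :: "real ^ 3" where "y0 = vector [of_int (3 * u1 - \<sigma>), of_int (3 * u2 - \<sigma>), of_int (3 * u3 - \<sigma>)]"
  define y where "y = (2 / 3) *\<^sub>R y0"
  have y0n: "y0 $ 1 = of_int (3 * u1 - \<sigma>)" "y0 $ 2 = of_int (3 * u2 - \<sigma>)" "y0 $ 3 = of_int (3 * u3 - \<sigma>)"
    by (simp_all add: y0_def vector_3)
  have un: "u $ 1 = 2 * of_int u1" "u $ 2 = 2 * of_int u2" "u $ 3 = 2 * of_int u3"
    by (simp_all add: u vector_3)
  have sum0: "w $ 1 + w $ 2 + w $ 3 = 0" if "w \<in> V" for w :: "real ^ 3"
  proof -
    obtain r x where "w = r *\<^sub>R x" "x \<in> A2_lattice" using \<open>w \<in> V\<close> unfolding V_def tensor_rat_def by auto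
    then show ?thesis by (simp add: A2_lattice_def flip: distrib_left)
  qed
  have "y0 \<in> A2_lattice"
    by (simp add: A2_lattice_def forall_3 y0n) (simp add: \<sigma>_def)
  moreover have "(2 / 3 :: real) \<in> \<rat>" by simp
  ultimately have yV: "y \<in> V" unfolding V_def tensor_rat_def y_def by blast
  have orth: "(u - y) \<bullet> w = 0" if "w \<in> V" for w :: "real ^ 3"
  proof -
    have "(u - y) \<bullet> w = (2 / 3) * of_int \<sigma> * (w $ 1 + w $ 2 + w $ 3)"
      by (simp add: inner_vec_def sum_3 y_def y0n un field_simps)
    then show ?thesis using sum0[OF that] by simp
  qed
  have "orth_projection V u = y"
    unfolding orth_projection_def
  proof (rule the_equality)
    show "y \<in> V \<and> (\<forall>w\<in>V. (u - y) \<bullet> w = 0)" using yV orth by blast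
    fix y' :: "real ^ 3" assume y': "y' \<in> V \<and> (\<forall>w\<in>V. (u - y') \<bullet> w = 0)"
    define e1 :: "real ^ 3" where "e1 = vector [1, 0, -1]"
    define e2 :: "real ^ 3" where "e2 = vector [0, 1, -1]"
    have "e1 \<in> A2_lattice" "e2 \<in> A2_lattice"
      by (simp_all add: A2_lattice_def forall_3 e1_def e2_def vector_3)
    moreover have "x \<in> V" if "x \<in> A2_lattice" for x
      unfolding V_def tensor_rat_def
      by (rule CollectI, rule exI[of _ 1], rule exI[of _ x]) (simp add: that)
    ultimately have "e1 \<in> V" "e2 \<in> V" by simp_all
    then have "(u - y') \<bullet> e1 = 0" "(u - y') \<bullet> e2 = 0" "(u - y) \<bullet> e1 = 0" "(u - y) \<bullet> e2 = 0"
      using y' orth by auto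
    then have "y' $ 1 - y' $ 3 = y $ 1 - y $ 3" "y' $ 2 - y' $ 3 = y $ 2 - y $ 3"
      by (simp_all add: inner_vec_def sum_3 e1_def e2_def vector_3)
    moreover have "y' $ 1 + y' $ 2 + y' $ 3 = 0" "y $ 1 + y $ 2 + y $ 3 = 0"
      using y' yV sum0 by auto
    ultimately have "y' $ 1 = y $ 1 \<and> y' $ 2 = y $ 2 \<and> y' $ 3 = y $ 3" by linarith
    then show "y' = y" by (simp add: vec_eq_iff forall_3)
  qed
  moreover have "x \<bullet> y = 0 \<longleftrightarrow> x $ 1 * of_int (u1 - u3) + x $ 2 * of_int (u2 - u3) = 0"
    if "x \<in> A2_lattice" for x :: "real ^ 3"
  proof -
    have x3: "x $ 3 = - (x $ 1 + x $ 2)" using that by (simp add: A2_lattice_def)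
    have xy: "x \<bullet> y = (2 / 3) * (x $ 1 * of_int (3 * u1 - \<sigma>) + x $ 2 * of_int (3 * u2 - \<sigma>) +
        x $ 3 * of_int (3 * u3 - \<sigma>))"
      by (simp add: inner_vec_def sum_3 y_def y0n field_simps)
    have "x \<bullet> y = 2 * (x $ 1 * of_int (u1 - u3) + x $ 2 * of_int (u2 - u3))"
      unfolding xy x3 by (simp add: field_simps)
    then show ?thesis by (simp only: mult_eq_0_iff) simp
  qed
  ultimately show ?thesis
    by (auto simp: A2_perp_def orth_sublattice_def V_def)
qed

text \<open>The sublattice is generated by the primitive vector proportional to
  \<open>(u\<^sub>2 - u\<^sub>3, u\<^sub>3 - u\<^sub>1, u\<^sub>1 - u\<^sub>2)\<close>.\<close>

lemma A2_perp_eq_line: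
  assumes u: "u = 2 *\<^sub>R vector [of_int u1, of_int u2, of_int u3]"
    and g: "g \<noteq> 0" "u2 - u3 = g * p" "u3 - u1 = g * q" "coprime p q" "p \<noteq> 0"
  shows "A2_perp u = A2_line p q"
proof (rule set_eqI)
  fix x :: "real ^ 3"
  have "u1 - u3 = - (g * q)" using g(3) by simp
  then have perp: "x \<in> A2_perp u \<longleftrightarrow> x \<in> A2_lattice \<and> x $ 2 * of_int p = x $ 1 * of_int q"
    unfolding A2_perp_eq_orthogonal[OF u] g(2) using g(1) by (auto simp: algebra_simps)
  show "x \<in> A2_perp u \<longleftrightarrow> x \<in> A2_line p q"
  proof
    assume "x \<in> A2_perp u"
    then have x: "x \<in> A2_lattice" "x $ 2 * of_int p = x $ 1 * of_int q" using perp by auto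
    then obtain x1 x2 :: int where x12: "x $ 1 = of_int x1" "x $ 2 = of_int x2"
      unfolding A2_lattice_def mem_Collect_eq by (meson Ints_cases)
    have "of_int (x2 * p) = (of_int (x1 * q) :: real)" using x(2) x12 by simp
    then have eq: "x2 * p = x1 * q" by (simp only: of_int_eq_iff)
    then have "p dvd x1 * q" by (metis dvd_triv_right)
    then have "p dvd x1" using g(4) by (simp add: coprime_dvd_mult_left_iff)
    then obtain t where t: "x1 = p * t" by (elim dvdE)
    then have "x2 = t * q" using eq g(5) by (simp add: mult_ac)
    then have "x = of_int t *\<^sub>R A2_vec p q"
      using x(1) x12 t by (simp add: vec_eq_iff forall_3 A2_lattice_def algebra_simps)
    then show "x \<in> A2_line p q" unfolding A2_line_def by (rule range_eqI)
  next
    assume xL: "x \<in> A2_line p q"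
    then obtain t :: int where "x = of_int t *\<^sub>R A2_vec p q" by (auto simp: A2_line_def)
    then show "x \<in> A2_perp u" using perp xL A2_line_subset by auto
  qed
qed

section \<open>The Fourier expansion on a rank one lattice\<close>

lemma odd_square: "odd (n::int) \<Longrightarrow> \<exists>k. n\<^sup>2 = 8 * k + 1"
proof -
  assume "odd n"
  then obtain m where m: "n = 2 * m + 1" by (elim oddE)
  have "even (m * (m + 1))" by simp
  then obtain k where "m * (m + 1) = 2 * k" by (elim evenE)
  then have "n\<^sup>2 = 8 * k + 1" by (simp add: m power2_eq_square algebra_simps)
  then show ?thesis ..
qed

text \<open>This is the inequality \<open>2n - (l, l) \<ge> 0\<close> for the exponents of \<open>\<vartheta>\<vartheta>\<vartheta>/\<eta>\<close>. The Gram
  determinant of \<open>(n\<^sub>1, n\<^sub>2, - n\<^sub>3)\<close>, \<open>(p, q, - p - q)\<close> and \<open>(1, 1, 1)\<close> is the square of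
  their determinant \<open>D\<close>, and \<open>n\<^sub>1 + n\<^sub>2 - n\<^sub>3\<close> is odd, hence of square at least one. That last
  contribution compensates exactly the factor \<open>q\<^bsup>-1/24\<^esup>\<close> of \<open>1/\<eta>\<close>.\<close>

lemma gram_bound:
  fixes n1 n2 n3 p q :: int
  assumes "odd n1" "odd n2" "odd n3"
  shows "6 * (n1 * p + n2 * q + n3 * (p + q))\<^sup>2 + 4 * half_norm p q \<le>
    12 * half_norm p q * (n1\<^sup>2 + n2\<^sup>2 + n3\<^sup>2)"
proof -
  define N where "N = half_norm p q"
  define D where "D = n1 * (p + 2 * q) - n2 * (2 * p + q) - n3 * (p - q)"
  have id: "6 * N * (n1\<^sup>2 + n2\<^sup>2 + n3\<^sup>2) - 3 * (n1 * p + n2 * q + n3 * (p + q))\<^sup>2 - 2 * N * (n1 + n2 - n3)\<^sup>2 = D\<^sup>2"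
    unfolding N_def half_norm_def D_def by (simp add: power2_eq_square algebra_simps)
  have N: "N \<ge> 0"
    using half_norm_pos[of p q] by (cases "p = 0") (auto simp: N_def half_norm_def)
  have "n1 + n2 - n3 \<noteq> 0" using assms by presburger
  then have "(n1 + n2 - n3)\<^sup>2 \<ge> 1"
    by (metis int_one_le_iff_zero_less zero_less_power2)
  then have "N * 1 \<le> N * (n1 + n2 - n3)\<^sup>2" using N by (intro mult_left_mono)
  moreover have "D\<^sup>2 \<ge> 0" by simp
  ultimately have "6 * (n1 * p + n2 * q + n3 * (p + q))\<^sup>2 + 4 * N \<le> 12 * (N * (n1\<^sup>2 + n2\<^sup>2 + n3\<^sup>2))"
    using id[unfolded mult.assoc[of 6] mult.assoc[of 2]] by linarith
  then show ?thesis by (simp add: N_def mult.assoc)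
qed

text \<open>No index has hyperbolic norm zero: write \<open>N\<close> for the half norm, \<open>n = k + 1/3\<close>, and
  \<open>r\<close> for the inner product of \<open>l\<close> with the generator, so that \<open>(l, l) = r\<^sup>2 / 2N\<close>. Then
  \<open>2n = (l, l)\<close> would give \<open>4N (3k + 1) = 3r\<^sup>2\<close>, so \<open>3\<close> would divide \<open>N\<close>.\<close>

lemma jacobi_index_set_positive:
  assumes p: "p \<noteq> 0" and N3: "\<not> 3 dvd half_norm p q"
    and nl: "(n, l) \<in> jacobi_index_set (A2_line p q) 8"
  shows "2 * n - l \<bullet> l > 0"
proof -
  define N where "N = half_norm p q"
  have Npos: "N > 0" using half_norm_pos[OF p] by (simp add: N_def)
  have le: "2 * n - l \<bullet> l \<ge> 0" and n: "n - 8 / 24 \<in> \<int>" and l: "l \<in> dual_lattice (A2_line p q)"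
    using nl by (auto simp: jacobi_index_set_def)
  obtain k :: int where "n - 8 / 24 = of_int k" using n by (rule Ints_cases)
  then have k: "n = of_int k + 1 / 3" by simp
  obtain \<alpha> where \<alpha>: "l = \<alpha> *\<^sub>R A2_vec p q"
  proof -
    obtain x y where xy: "l = x *\<^sub>R y" "y \<in> A2_line p q"
      using l unfolding dual_lattice_def tensor_rat_def by auto
    then obtain t :: int where "y = of_int t *\<^sub>R A2_vec p q" by (auto simp: A2_line_def)
    with xy have "l = (x * of_int t) *\<^sub>R A2_vec p q" by simp
    then show ?thesis by (rule that)
  qed
  have "A2_vec p q \<in> A2_line p q" unfolding A2_line_def by (rule range_eqI[of _ _ 1]) simp
  then have "l \<bullet> A2_vec p q \<in> \<int>" using l by (simp add: dual_lattice_def)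
  then obtain r :: int where r: "\<alpha> * (2 * of_int N) = of_int r"
    by (auto simp: \<alpha> A2_vec_inner_self N_def elim!: Ints_cases)
  have "2 * n - l \<bullet> l \<noteq> 0"
  proof
    assume z: "2 * n - l \<bullet> l = 0"
    have "l \<bullet> l = \<alpha> * \<alpha> * (2 * of_int N)" by (simp add: \<alpha> A2_vec_inner_self N_def)
    then have "(2 * of_int N) * (l \<bullet> l) = (\<alpha> * (2 * of_int N)) * (\<alpha> * (2 * of_int N))" by simp
    then have "3 * ((2 * of_int N) * (2 * n)) = 3 * (of_int r * of_int r)"
      using z unfolding r by simp
    then have "of_int (4 * N * (3 * k + 1)) = (of_int (3 * (r * r)) :: real)"
      by (simp add: k algebra_simps)
    then have "4 * N * (3 * k + 1) = 3 * (r * r)" by (simp only: of_int_eq_iff)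
    then have "3 dvd 4 * N * (3 * k + 1)" by simp
    then have "3 dvd 4 * N \<or> 3 dvd 3 * k + 1"
      by (subst (asm) prime_dvd_mult_iff) auto
    then have "3 dvd N" by presburger
    then show False using N3 by (simp add: N_def)
  qed
  with le show ?thesis by simp
qed

text \<open>Multiplying the three theta series with the expansion of \<open>1/\<eta>\<close> and collecting the terms of
  equal exponent; the coefficients are sums over the fibres of \<open>key\<close>.\<close>

lemma sigma_A2_fourier:
  assumes p: "p \<noteq> 0"
  shows "\<exists>f. jacobi_fourier_expansion (A2_line p q) 8 sigma_A2 f"
proof -
  define N where "N = half_norm p q"
  have Npos: "N > 0" using half_norm_pos[OF p] by (simp add: N_def)
  define w where "w = A2_vec p q"
  define L where "L = A2_line p q"
  obtain A :: "nat \<Rightarrow> complex" where A: "\<forall>\<tau>. Im \<tau> > 0 \<longrightarrow>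
     (\<lambda>m. norm (A m * exp (2 * pi * \<i> * ((of_nat m - 1 / 24) * \<tau>)))) summable_on UNIV \<and>
     ((\<lambda>m. A m * exp (2 * pi * \<i> * ((of_nat m - 1 / 24) * \<tau>))) has_sum inverse (dedekind_eta \<tau>)) UNIV"
    using inverse_eta_expansion ..
  \<comment> \<open>summation indices with their exponents \<open>n\<close> and \<open>r\<close> of \<open>e\<^bsup>2\<pi>i(n\<tau> + rs)\<^esup>\<close> at the point \<open>s w\<close>\<close>
  define X :: "(((int \<times> int) \<times> int) \<times> nat) set" where
    "X = {(((n1, n2), n3), m). odd n1 \<and> odd n2 \<and> odd n3}"
  define ex :: "((int \<times> int) \<times> int) \<times> nat \<Rightarrow> real" where
    "ex = (\<lambda>(((n1, n2), n3), m). of_int (n1\<^sup>2 + n2\<^sup>2 + n3\<^sup>2) / 8 + of_nat m - 1 / 24)"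
  define rr :: "((int \<times> int) \<times> int) \<times> nat \<Rightarrow> real" where
    "rr = (\<lambda>(((n1, n2), n3), m). of_int (n1 * p + n2 * q + n3 * (p + q)) / 2)"
  define key where "key x = (ex x, (rr x / (2 * of_int N)) *\<^sub>R w)" for x
  define co :: "((int \<times> int) \<times> int) \<times> nat \<Rightarrow> complex" where
    "co = (\<lambda>(((n1, n2), n3), m). of_int (chi4 n1) * of_int (chi4 n2) * of_int (chi4 n3) * A m)"
  define f where "f n l = infsum co {x \<in> X. key x = (n, l)}" for n l
  have ww: "w \<bullet> w = 2 * of_int N" by (simp add: w_def A2_vec_inner_self N_def)
  have key: "key ` X \<subseteq> jacobi_index_set L 8"
  proof clarify
    fix n l n1 n2 n3 :: int and m :: nat
    fix k' :: real and l' assume *: "(k', l') = key (((n1, n2), n3), m)" and "(((n1, n2), n3), m) \<in> X"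
    then have odd: "odd n1" "odd n2" "odd n3" by (auto simp: X_def)
    define R where "R = n1 * p + n2 * q + n3 * (p + q)"
    have kl: "k' = of_int (n1\<^sup>2 + n2\<^sup>2 + n3\<^sup>2) / 8 + of_nat m - 1 / 24" "l' = (of_int R / 2 / (2 * of_int N)) *\<^sub>R w"
      using * by (auto simp: key_def ex_def rr_def R_def)
    obtain k1 k2 k3 where k: "n1\<^sup>2 = 8 * k1 + 1" "n2\<^sup>2 = 8 * k2 + 1" "n3\<^sup>2 = 8 * k3 + 1"
      using odd_square[OF odd(1)] odd_square[OF odd(2)] odd_square[OF odd(3)] by auto
    have k'3: "k' = of_int (k1 + k2 + k3 + int m) + 1 / 3"
      unfolding kl k by (simp add: field_simps)
    have "even R" unfolding R_def using odd by simp
    then obtain r where r: "R = 2 * r" by (elim evenE)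
    have l': "l' = (of_int r / (2 * of_int N)) *\<^sub>R w" by (simp add: kl r)
    have dual: "l' \<in> dual_lattice L"
      unfolding dual_lattice_def
    proof (intro CollectI conjI ballI)
      have "w \<in> L" unfolding L_def A2_line_def w_def by (rule range_eqI[of _ _ 1]) simp
      moreover have "of_int r / (2 * of_int N) \<in> (\<rat> :: real set)" by simp
      ultimately show "l' \<in> tensor_rat L" unfolding tensor_rat_def l' by blast
      fix x assume "x \<in> L"
      then obtain t :: int where "x = of_int t *\<^sub>R w" by (auto simp: L_def A2_line_def w_def)
      then have "l' \<bullet> x = of_int (r * t)" using Npos by (simp add: l' ww field_simps)
      then show "l' \<bullet> x \<in> \<int>" by simp
    qed
    have ll: "l' \<bullet> l' = of_int (R\<^sup>2) / (8 * of_int N)"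
      using Npos by (simp add: kl ww power2_eq_square field_simps)
    have "of_int (6 * R\<^sup>2 + 4 * N) \<le> (of_int (12 * N * (n1\<^sup>2 + n2\<^sup>2 + n3\<^sup>2)) :: real)"
      unfolding of_int_le_iff using gram_bound[OF odd, of p q] by (simp add: R_def N_def)
    then have "l' \<bullet> l' \<le> of_int (n1\<^sup>2 + n2\<^sup>2 + n3\<^sup>2) / 4 - 1 / 12"
      unfolding ll using Npos by (simp add: field_simps)
    also have "\<dots> \<le> 2 * k'" unfolding kl by (simp add: field_simps)
    finally have bound: "2 * k' - l' \<bullet> l' \<ge> 0" by simp
    moreover have "l' \<bullet> l' \<ge> 0" by simp
    ultimately have "k' \<ge> 0" by linarith
    moreover have "k' \<in> \<rat>" unfolding k'3 by simp
    moreover have "k' - of_int 8 / 24 \<in> \<int>" unfolding k'3 by simp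
    ultimately show "(k', l') \<in> jacobi_index_set L 8"
      using dual bound by (simp add: jacobi_index_set_def)
  qed
  have "jacobi_fourier_expansion L 8 sigma_A2 f"
    unfolding jacobi_fourier_expansion_def
  proof (intro ballI)
    fix \<tau> Z assume "\<tau> \<in> upper_half" and Z: "Z \<in> tensor_complex L"
    then have \<tau>: "Im \<tau> > 0" by (simp add: upper_half_def)
    obtain s where s: "Z = s *s cvec w"
      using Z unfolding L_def w_def by (rule tensor_complex_A2_line)
    define T where "T z n = theta_term 0 \<tau> z n" for z n
    define B where "B m = A m * exp (2 * pi * \<i> * ((of_nat m - 1 / 24) * \<tau>))" for m
    have T: "(\<lambda>n. norm (T z n)) summable_on UNIV" "(T z has_sum theta \<tau> z) UNIV" for z
      using theta_term_abs_summable[OF \<tau>, of 0 z] theta_term_has_sum[OF \<tau>, of 0 z]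
      by (simp_all add: T_def[abs_def] theta_eq_moment)
    define G where "G = (\<lambda>(((n1, n2), n3), m). T (of_int p * s) n1 * T (of_int q * s) n2 * T (of_int (p + q) * s) n3 * B m)"
    have Geq: "G x = co x * exp (2 * pi * \<i> * (of_real (ex x) * \<tau> + of_real (rr x) * s))" for x
    proof -
      obtain n1 n2 n3 m where x: "x = (((n1, n2), n3), m)" by (metis prod.exhaust)
      show ?thesis
      proof -
        have "exp (2 * pi * \<i> * (of_real (ex x) * \<tau> + of_real (rr x) * s)) =
          exp (2 * pi * \<i> * (of_int n1 ^ 2 / 8 * \<tau> + of_int n1 / 2 * (of_int p * s))) *
          exp (2 * pi * \<i> * (of_int n2 ^ 2 / 8 * \<tau> + of_int n2 / 2 * (of_int q * s))) *
          exp (2 * pi * \<i> * (of_int n3 ^ 2 / 8 * \<tau> + of_int n3 / 2 * (of_int (p + q) * s))) *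
          exp (2 * pi * \<i> * ((of_nat m - 1 / 24) * \<tau>))"
          unfolding exp_add[symmetric]
          by (rule arg_cong[where f = exp]) (simp add: x ex_def rr_def field_simps)
        then show ?thesis
          by (simp add: x G_def co_def T_def B_def theta_term_def mult_ac)
      qed
    qed
    have sum1: "(\<lambda>(x, y). norm (T (of_int p * s) x * T (of_int q * s) y)) summable_on UNIV \<times> UNIV"
      "((\<lambda>(x, y). T (of_int p * s) x * T (of_int q * s) y) has_sum theta \<tau> (of_int p * s) * theta \<tau> (of_int q * s)) (UNIV \<times> UNIV)"
      by (rule has_sum_times[OF T T])+
    have sum2: "(\<lambda>(x, y). norm ((\<lambda>(x, y). T (of_int p * s) x * T (of_int q * s) y) x * T (of_int (p + q) * s) y)) summable_on (UNIV \<times> UNIV) \<times> UNIV"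
      "((\<lambda>(x, y). (\<lambda>(x, y). T (of_int p * s) x * T (of_int q * s) y) x * T (of_int (p + q) * s) y) has_sum
        theta \<tau> (of_int p * s) * theta \<tau> (of_int q * s) * theta \<tau> (of_int (p + q) * s)) ((UNIV \<times> UNIV) \<times> UNIV)"
      by (rule has_sum_times[OF _ sum1(2) T]; use sum1(1) in \<open>simp add: case_prod_beta'\<close>)+
    have "((\<lambda>(x, y). (\<lambda>(x, y). (\<lambda>(x, y). T (of_int p * s) x * T (of_int q * s) y) x * T (of_int (p + q) * s) y) x * B y) has_sum
        theta \<tau> (of_int p * s) * theta \<tau> (of_int q * s) * theta \<tau> (of_int (p + q) * s) * inverse (dedekind_eta \<tau>))
        (((UNIV \<times> UNIV) \<times> UNIV) \<times> UNIV)"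
    proof (rule has_sum_times(2)[OF _ sum2(2)])
      show "(\<lambda>m. norm (B m)) summable_on UNIV" "(B has_sum inverse (dedekind_eta \<tau>)) UNIV"
        using A \<tau> by (simp_all add: B_def[abs_def])
    qed (use sum2(1) in \<open>simp add: case_prod_beta'\<close>)
    moreover have "(\<lambda>(x, y). (\<lambda>(x, y). (\<lambda>(x, y). T (of_int p * s) x * T (of_int q * s) y) x * T (of_int (p + q) * s) y) x * B y) = G"
      by (simp add: G_def fun_eq_iff)
    moreover have "theta \<tau> (of_int p * s) * theta \<tau> (of_int q * s) * theta \<tau> (of_int (p + q) * s) * inverse (dedekind_eta \<tau>) =
        sigma_A2 (\<tau>, Z)"
      by (simp add: s sigma_A2_apply cvec_def w_def divide_inverse algebra_simps)
    ultimately have "(G has_sum sigma_A2 (\<tau>, Z)) UNIV" by simp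
    then have GX: "(G has_sum sigma_A2 (\<tau>, Z)) X"
    proof (rule has_sum_cong_neutral[THEN iffD1, rotated -1])
      fix x assume "x \<in> UNIV - X"
      then show "G x = 0"
        by (auto simp: X_def G_def T_def theta_term_def chi4_even)
    qed auto
    have "((\<lambda>i. infsum G {x \<in> X. key x = i}) has_sum sigma_A2 (\<tau>, Z)) (jacobi_index_set L 8)"
      by (rule has_sum_group_by[OF GX key])
    moreover have "infsum G {x \<in> X. key x = i} =
        (case i of (n, l) \<Rightarrow> f n l * exp (2 * pi * \<i> * (of_real n * \<tau> + cform (cvec l) Z)))"
      if "i \<in> jacobi_index_set L 8" for i
    proof -
      obtain n l where i: "i = (n, l)" by fastforce
      have "infsum G {x \<in> X. key x = i} =
          infsum (\<lambda>x. co x * exp (2 * pi * \<i> * (of_real n * \<tau> + cform (cvec l) Z))) {x \<in> X. key x = i}"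
      proof (rule infsum_cong)
        fix x assume "x \<in> {x \<in> X. key x = i}"
        then have n: "n = ex x" and l: "l = (rr x / (2 * of_int N)) *\<^sub>R w" by (auto simp: key_def i)
        have "cform (cvec l) Z = of_real (rr x) / (2 * of_int N) * s * of_real (w \<bullet> w)"
          unfolding s l cform_3 by (simp add: cvec_def inner_vec_def sum_3 algebra_simps)
        also have "\<dots> = of_real (rr x) * s" using Npos by (simp add: ww)
        finally show "G x = co x * exp (2 * pi * \<i> * (of_real n * \<tau> + cform (cvec l) Z))"
          unfolding Geq n by simp
      qed
      also have "\<dots> = f n l * exp (2 * pi * \<i> * (of_real n * \<tau> + cform (cvec l) Z))"
        unfolding f_def i by (rule infsum_cmult_left')
      finally show ?thesis by (simp add: i)
    qed
    ultimately show "((\<lambda>(n, l). f n l * exp (2 * pi * \<i> * (of_real n * \<tau> + cform (cvec l) Z))) has_sum sigma_A2 (\<tau>, Z))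
        (jacobi_index_set L 8)"
      by (subst (asm) has_sum_cong) auto
  qed
  then show ?thesis unfolding L_def by blast
qed

section \<open>The restricted form\<close>

lemma jacobi_form_A2_line:
  fixes p q :: int
  assumes p: "p \<noteq> 0"
  defines "L \<equiv> A2_line p q"
  shows "jacobi_form L 1 8 (restrict sigma_A2 (upper_half \<times> tensor_complex L))"
proof -
  define S where "S = upper_half \<times> tensor_complex L"
  have Z3: "Z $ 3 = - (Z $ 1 + Z $ 2)" if "Z \<in> tensor_complex L" for Z :: "complex ^ 3"
  proof -
    obtain s where "Z = s *s cvec (A2_vec p q)"
      using \<open>Z \<in> tensor_complex L\<close> unfolding L_def by (rule tensor_complex_A2_line)
    then show ?thesis by (simp add: cvec_def algebra_simps)
  qed
  have scale: "c *s Z \<in> tensor_complex L" if "Z \<in> tensor_complex L" for c Z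
    using that unfolding tensor_complex_def by (rule vec.span_scale)
  have add: "Z + W \<in> tensor_complex L" if "Z \<in> tensor_complex L" "W \<in> tensor_complex L" for Z W
    using that unfolding tensor_complex_def by (rule vec.span_add)
  have base: "cvec x \<in> tensor_complex L" if "x \<in> L" for x
    using that unfolding tensor_complex_def by (intro vec.span_base imageI)
  obtain f where f: "jacobi_fourier_expansion L 8 sigma_A2 f"
    using sigma_A2_fourier[OF p] L_def by blast
  show ?thesis
    unfolding jacobi_form_def S_def[symmetric]
  proof (intro conjI allI impI ballI)
    show "even_lattice L" unfolding L_def by (rule even_lattice_A2_line[OF p])
    show "holomorphic_within (restrict sigma_A2 S) S"
      by (rule holomorphic_within_restrict_sigma_A2) (auto simp: S_def)
    show "\<exists>f. jacobi_fourier_expansion L 8 (restrict sigma_A2 S) f"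
      using f by (auto simp: jacobi_fourier_expansion_def S_def)
  next
    fix a b c d :: int and \<tau> Z
    assume det: "a * d - b * c = 1" and \<tau>: "\<tau> \<in> upper_half" and Z: "Z \<in> tensor_complex L"
    have "Im \<tau> > 0" using \<tau> by (simp add: upper_half_def)
    moreover from Im_moebius[OF det this]
    have "(of_int a * \<tau> + of_int b) / (of_int c * \<tau> + of_int d) \<in> upper_half"
      by (simp add: upper_half_def moebius_def[OF det] cocycle_def[OF det])
    ultimately show "restrict sigma_A2 S ((of_int a * \<tau> + of_int b) / (of_int c * \<tau> + of_int d),
        (1 / (of_int c * \<tau> + of_int d)) *s Z) =
      v_eta a b c d powi 8 * (of_int c * \<tau> + of_int d) powr (of_real 1) *
      exp (pi * \<i> * (of_int c * cform Z Z / (of_int c * \<tau> + of_int d))) * restrict sigma_A2 S (\<tau>, Z)"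
      using sigma_A2_modular[OF det _ Z3[OF Z], of \<tau>] \<tau> Z scale[OF Z] by (simp add: S_def)
  next
    fix x y \<tau> Z
    assume x: "x \<in> L" and y: "y \<in> L" and \<tau>: "\<tau> \<in> upper_half" and Z: "Z \<in> tensor_complex L"
    have "x \<in> A2_lattice" "y \<in> A2_lattice" using x y A2_line_subset by (auto simp: L_def)
    from sigma_A2_elliptic[OF this Z3[OF Z], of \<tau>] \<tau> Z x y
    show "restrict sigma_A2 S (\<tau>, Z + \<tau> *s cvec x + cvec y) =
      exp (- pi * \<i> * (of_real (x \<bullet> x) * \<tau> + 2 * cform (cvec x) Z)) * restrict sigma_A2 S (\<tau>, Z)"
      by (simp add: S_def add scale base)
  qed simp
qed

theorem proposition3p8:
  fixes u :: "real ^ 3" and u1 u2 u3 :: int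
  assumes "u \<in> D3_lattice"
    and "u = 2 *\<^sub>R vector [of_int u1, of_int u2, of_int u3]"
    and "u1 \<noteq> u2" and "u1 \<noteq> u3" and "u2 \<noteq> u3"
    and "(u1 + u2 + u3) mod 3 \<noteq> 0"
  shows "dim (A2_perp u) = 1 \<and> critical_weight (A2_perp u) = 1 \<and>
    jacobi_cusp_form (A2_perp u) 1 8 (sigma_A2_restr u)"
proof -
  define g where "g = gcd (u2 - u3) (u3 - u1)"
  have g0: "g \<noteq> 0" using assms(5) by (simp add: g_def)
  have "\<exists>p q. u2 - u3 = p * g \<and> u3 - u1 = q * g \<and> coprime p q"
    unfolding g_def by (rule gcd_coprime_exists) (use g0 in \<open>simp only: g_def not_False_eq_True\<close>)
  then obtain p q where pq': "u2 - u3 = p * g" "u3 - u1 = q * g" "coprime p q" by (elim exE conjE)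
  then have pq: "u2 - u3 = g * p" "u3 - u1 = g * q" "coprime p q" by (simp_all only: mult.commute)
  have p: "p \<noteq> 0" using pq(1) assms(5) by auto
  have L: "A2_perp u = A2_line p q"
    by (rule A2_perp_eq_line[OF assms(2) g0 pq p])
  have N3: "\<not> 3 dvd half_norm p q"
  proof
    assume "3 dvd half_norm p q"
    \<comment> \<open>\<open>half_norm p q\<close> is congruent to \<open>(p - q)\<^sup>2\<close>, and \<open>g (p - q)\<close> to \<open>u1 + u2 + u3\<close>, modulo 3\<close>
    then have "3 dvd (half_norm p q - 3 * (p * q))" by (intro dvd_diff) auto
    also have "half_norm p q - 3 * (p * q) = (p - q)\<^sup>2"
      by (simp add: half_norm_def power2_eq_square algebra_simps)
    finally have "3 dvd p - q"
      by (rule prime_dvd_power[rotated]) simp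
    then have "3 dvd g * (p - q)" by simp
    then have "3 dvd (u2 - u3) - (u3 - u1)" unfolding pq(1,2) by (simp add: algebra_simps)
    then show False using assms(6) by presburger
  qed
  have jf: "jacobi_form (A2_perp u) 1 8 (sigma_A2_restr u)"
    unfolding sigma_A2_restr_def L by (rule jacobi_form_A2_line[OF p])
  then obtain f where "jacobi_fourier_expansion (A2_perp u) 8 (sigma_A2_restr u) f"
    unfolding jacobi_form_def by blast
  then have "jacobi_cusp_form (A2_perp u) 1 8 (sigma_A2_restr u)"
    unfolding jacobi_cusp_form_def using jf jacobi_index_set_positive[OF p N3] by (auto simp: L)
  then show ?thesis
    using dim_A2_line[OF p, of q] by (simp add: critical_weight_def L)
qed

end
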